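(* The kernel of the Com-Prelie algebra morphism $\phi_{CPL}:\mathfrak{g}_{\mathcal{PT}(\{1,2\})}\to\mathbb{K}\langle x_0,x_1\rangle$ is the Com-Prelie ideal generated by the elements: 1. $\cdot_1\bullet t_1\ldots t_k$, where $k\ge1$, $t_1,\ldots,t_k\in\mathcal{PT}(\{1,2\})$; 2. $\cdot_2\bullet t_1\ldots t_k$, where $k\ge2$, $t_1,\ldots,t_k\in\mathcal{PT}(\{1,2\})$; 3. $\cdot_1\sqcup\!\sqcup t-t$, where $t\in\mathcal{PT}(\{1,2\})$; 4. $(\cdot_2\bullet t)\sqcup\!\sqcup(\cdot_2\bullet t')-\cdot_2\bullet\bigl((\cdot_2\bullet t)\sqcup\!\sqcup t'+t\sqcup\!\sqcup(\cdot_2\bullet t')\bigr)$, where $t,t'\in\mathcal{PT}(\{1,2\})$.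
   Context: All vector spaces are over a field $\mathbb{K}$ of characteristic zero. A Com-Prelie algebra is a triple $(A,\bullet,\sqcup\!\sqcup)$ where $A$ is a vector space, $\bullet$ is a right prelie product ($(x\bullet y)\bullet z-x\bullet(y\bullet z)=(x\bullet z)\bullet y-x\bullet(z\bullet y)$), $\sqcup\!\sqcup$ is a commutative associative product (not necessarily unitary), and $(a\sqcup\!\sqcup b)\bullet c=(a\bullet c)\sqcup\!\sqcup b+a\sqcup\!\sqcup(b\bullet c)$. A Com-Prelie ideal is a subspace $I$ with $I\bullet A$, $A\bullet I$, $I\sqcup\!\sqcup A\subseteq I$. A partitioned forest is a pair $(F,I)$ where $F$ is a rooted forest (edges oriented from the leaves to the roots) and $I$ is a partition of the set of vertices of $F$ such that if two vertices are in the same part of $I$, then either they are both roots, or they have the same direct descendant (i.e. are attached to the same vertex immediately below them). A partitioned tree is a (nonempty) partitioned forest all of whose roots are in the same part; it is decorated by $\mathcal{D}$ if given with a map from its vertices to $\mathcal{D}$. $\mathcal{PT}(\mathcal{D})$ is the set of isoclasses of partitioned trees decorated by $\mathcal{D}$, and $\mathfrak{g}_{\mathcal{PT}(\mathcal{D})}$ is the vector space with basis $\mathcal{PT}(\mathcal{D})$. $\cdot_d$ is the tree with one vertex, decorated by $d$. For $t,t'\in\mathcal{PT}(\mathcal{D})$ and $s$ a vertex of $t$, $t\bullet_st'$ is obtained by grafting all the roots of $t'$ on the vertex $s$ of $t$, the partition being the disjoint union of the partitions of $t$ and $t'$; $t\bullet t'=\sum_{s\in V(t)}t\bullet_st'$.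 The partitioned tree $t\sqcup\!\sqcup t'$ is the disjoint union $tt'$ as a rooted forest, its partition being obtained from the disjoint union of the partitions by merging the part formed by the roots of $t$ with the part formed by the roots of $t'$. These products make $\mathfrak{g}_{\mathcal{PT}(\mathcal{D})}$ the free Com-Prelie algebra generated by the $\cdot_d$, $d\in\mathcal{D}$. The element $\cdot_d\bullet t_1\ldots t_k$ is the partitioned tree obtained by grafting all the roots of $t_1,\ldots,t_k$ on a single root decorated by $d$, the partition being the disjoint union of the singleton of the root and of the partitions of $t_1,\ldots,t_k$. On $\mathbb{K}\langle x_0,x_1\rangle$ (span of words, $\emptyset$ the empty word), $\sqcup\!\sqcup$ is the shuffle product, and $\bullet$ is the bilinear product determined by: for all words $c,d$, $\emptyset\bullet d=0$, $(x_0c)\bullet d=x_0(c\bullet d)$, $(x_1c)\bullet d=x_1(c\bullet d)+x_0(c\sqcup\!\sqcup d)$. This is a Com-Prelie algebra. $\phi_{CPL}$ is the unique Com-Prelie algebra morphism with $\phi_{CPL}(\cdot_1)=\emptyset$ and $\phi_{CPL}(\cdot_2)=x_1$. *)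

theory Defs
  imports Complex_Main
    "HOL-Library.Poly_Mapping"
    "HOL-Library.Disjoint_Sets"
    "HOL-Library.Nat_Bijection"
begin

section \<open>Free vector spaces\<close>

text \<open>The vector space over \<open>'k\<close> with basis \<open>'a\<close> is the type \<open>'a \<Rightarrow>\<^sub>0 'k\<close>; the basis
  vector of \<open>a\<close> is \<open>basis a\<close>.\<close>

definition scale :: "'k::field \<Rightarrow> ('a \<Rightarrow>\<^sub>0 'k) \<Rightarrow> ('a \<Rightarrow>\<^sub>0 'k)" where
  "scale c p = Poly_Mapping.map ((*) c) p"

lemma lookup_scale [simp]: "Poly_Mapping.lookup (scale c p) a = c * Poly_Mapping.lookup p a"
  by (simp add: scale_def Poly_Mapping.map.rep_eq when_def)

global_interpretation free_vs: vector_space "scale :: 'k::field \<Rightarrow> ('a \<Rightarrow>\<^sub>0 'k) \<Rightarrow> _"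
  by standard (auto intro!: poly_mapping_eqI simp: lookup_add algebra_simps)

definition basis :: "'a \<Rightarrow> ('a \<Rightarrow>\<^sub>0 'k::field)" where
  "basis a = Poly_Mapping.single a 1"

definition linear_ext :: "('a \<Rightarrow> ('b \<Rightarrow>\<^sub>0 'k)) \<Rightarrow> ('a \<Rightarrow>\<^sub>0 'k::field) \<Rightarrow> ('b \<Rightarrow>\<^sub>0 'k)" where
  "linear_ext f p = (\<Sum>a\<in>Poly_Mapping.keys p. scale (Poly_Mapping.lookup p a) (f a))"

definition bilinear_ext ::
  "('a \<Rightarrow> 'b \<Rightarrow> ('c \<Rightarrow>\<^sub>0 'k)) \<Rightarrow> ('a \<Rightarrow>\<^sub>0 'k::field) \<Rightarrow> ('b \<Rightarrow>\<^sub>0 'k) \<Rightarrow> ('c \<Rightarrow>\<^sub>0 'k)" where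
  "bilinear_ext f p q = (\<Sum>a\<in>Poly_Mapping.keys p. \<Sum>b\<in>Poly_Mapping.keys q.
     scale (Poly_Mapping.lookup p a * Poly_Mapping.lookup q b) (f a b))"


section \<open>Com-Prelie morphisms and ideals\<close>

text \<open>In each triple below, \<open>s\<close> is the scalar multiplication, \<open>b\<close> the prelie product and
  \<open>m\<close> the commutative product.\<close>

definition com_prelie_hom ::
  "('k::field \<Rightarrow> 'a::ab_group_add \<Rightarrow> 'a) \<Rightarrow> ('a \<Rightarrow> 'a \<Rightarrow> 'a) \<Rightarrow> ('a \<Rightarrow> 'a \<Rightarrow> 'a) \<Rightarrow>
   ('k \<Rightarrow> 'b::ab_group_add \<Rightarrow> 'b) \<Rightarrow> ('b \<Rightarrow> 'b \<Rightarrow> 'b) \<Rightarrow> ('b \<Rightarrow> 'b \<Rightarrow> 'b) \<Rightarrow> ('a \<Rightarrow> 'b) \<Rightarrow> bool" where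
  "com_prelie_hom s b m s' b' m' f \<longleftrightarrow>
     Vector_Spaces.linear s s' f \<and>
     (\<forall>x y. f (b x y) = b' (f x) (f y)) \<and>
     (\<forall>x y. f (m x y) = m' (f x) (f y))"

definition com_prelie_ideal ::
  "('k::field \<Rightarrow> 'a::ab_group_add \<Rightarrow> 'a) \<Rightarrow> ('a \<Rightarrow> 'a \<Rightarrow> 'a) \<Rightarrow> ('a \<Rightarrow> 'a \<Rightarrow> 'a) \<Rightarrow> 'a set \<Rightarrow> bool" where
  "com_prelie_ideal s b m I \<longleftrightarrow>
     module.subspace s I \<and> (\<forall>x\<in>I. \<forall>y. b x y \<in> I \<and> b y x \<in> I \<and> m x y \<in> I)"

definition com_prelie_ideal_generated ::
  "('k::field \<Rightarrow> 'a::ab_group_add \<Rightarrow> 'a) \<Rightarrow> ('a \<Rightarrow> 'a \<Rightarrow> 'a) \<Rightarrow> ('a \<Rightarrow> 'a \<Rightarrow> 'a) \<Rightarrow> 'a set \<Rightarrow> 'a set" where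
  "com_prelie_ideal_generated s b m S = \<Inter>{I. com_prelie_ideal s b m I \<and> S \<subseteq> I}"


section \<open>Decorated partitioned forests and trees\<close>

text \<open>An edge \<open>(v, w)\<close> is oriented towards the root: \<open>w\<close> is the direct descendant of \<open>v\<close>.
  The values of \<open>dec\<close> outside \<open>verts\<close> are irrelevant.\<close>

record 'd pforest =
  verts :: "nat set"
  edges :: "(nat \<times> nat) set"
  parts :: "nat set set"
  dec :: "nat \<Rightarrow> 'd"

definition roots :: "'d pforest \<Rightarrow> nat set" where
  "roots F = {v \<in> verts F. \<forall>w. (v, w) \<notin> edges F}"

definition rooted_forest :: "'d pforest \<Rightarrow> bool" where
  "rooted_forest F \<longleftrightarrow>
     finite (verts F) \<and> edges F \<subseteq> verts F \<times> verts F \<and> single_valued (edges F) \<and> acyclic (edges F)"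

definition partitioned_forest :: "'d pforest \<Rightarrow> bool" where
  "partitioned_forest F \<longleftrightarrow>
     rooted_forest F \<and> partition_on (verts F) (parts F) \<and>
     (\<forall>B\<in>parts F. \<forall>v\<in>B. \<forall>w\<in>B.
        (v \<in> roots F \<and> w \<in> roots F) \<or> (\<exists>u. (v, u) \<in> edges F \<and> (w, u) \<in> edges F))"

definition partitioned_tree :: "'d pforest \<Rightarrow> bool" where
  "partitioned_tree F \<longleftrightarrow>
     partitioned_forest F \<and> verts F \<noteq> {} \<and> (\<exists>B\<in>parts F. roots F \<subseteq> B)"

definition pforest_iso_via :: "(nat \<Rightarrow> nat) \<Rightarrow> 'd pforest \<Rightarrow> 'd pforest \<Rightarrow> bool" where
  "pforest_iso_via f F G \<longleftrightarrow>
     bij_betw f (verts F) (verts G) \<and>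
     (\<forall>v\<in>verts F. \<forall>w\<in>verts F. (v, w) \<in> edges F \<longleftrightarrow> (f v, f w) \<in> edges G) \<and>
     (image f) ` parts F = parts G \<and>
     (\<forall>v\<in>verts F. dec G (f v) = dec F v)"

definition ptree_iso :: "'d pforest \<Rightarrow> 'd pforest \<Rightarrow> bool" where
  "ptree_iso F G \<longleftrightarrow> partitioned_tree F \<and> partitioned_tree G \<and> (\<exists>f. pforest_iso_via f F G)"

definition single_vertex :: "'d \<Rightarrow> 'd pforest" where
  "single_vertex d = \<lparr>verts = {0}, edges = {}, parts = {{0}}, dec = (\<lambda>_. d)\<rparr>"

text \<open>Disjoint union of a list of forests: the vertex \<open>v\<close> of the \<open>i\<close>-th forest becomes
  \<open>prod_encode (i, v)\<close>.\<close>

abbreviation emb :: "nat \<Rightarrow> nat \<Rightarrow> nat" where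
  "emb i v \<equiv> prod_encode (i, v)"

definition disjoint_union :: "'d pforest list \<Rightarrow> 'd pforest" where
  "disjoint_union Fs = \<lparr>
     verts = (\<Union>i<length Fs. emb i ` verts (Fs ! i)),
     edges = (\<Union>i<length Fs. map_prod (emb i) (emb i) ` edges (Fs ! i)),
     parts = (\<Union>i<length Fs. image (emb i) ` parts (Fs ! i)),
     dec = (\<lambda>x. dec (Fs ! fst (prod_decode x)) (snd (prod_decode x)))\<rparr>"

text \<open>\<open>graft F s Gs\<close> grafts all the roots of all the forests in \<open>Gs\<close> on the vertex \<open>s\<close> of \<open>F\<close>.\<close>

definition graft :: "'d pforest \<Rightarrow> nat \<Rightarrow> 'd pforest list \<Rightarrow> 'd pforest" where
  "graft F s Gs = (let U = disjoint_union (F # Gs) in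
     U\<lparr>edges := edges U \<union> (\<Union>i<length Gs. (\<lambda>v. (emb (Suc i) v, emb 0 s)) ` roots (Gs ! i))\<rparr>)"

definition merge :: "'d pforest \<Rightarrow> 'd pforest \<Rightarrow> 'd pforest" where
  "merge F G = (let U = disjoint_union [F, G]; R = emb 0 ` roots F; S = emb 1 ` roots G in
     U\<lparr>parts := parts U - {R, S} \<union> {R \<union> S}\<rparr>)"


subsection \<open>Compatibility with isomorphisms\<close>

lemma pforest_iso_via_refl: "pforest_iso_via id F F"
  by (simp add: pforest_iso_via_def)

lemma partitioned_forestD:
  assumes "partitioned_forest F"
  shows "finite (verts F)" "edges F \<subseteq> verts F \<times> verts F" "single_valued (edges F)"
    "acyclic (edges F)" "partition_on (verts F) (parts F)" "\<Union> (parts F) = verts F"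
  using assms by (auto simp: partitioned_forest_def rooted_forest_def partition_on_def)

lemma partitioned_treeD:
  assumes "partitioned_tree F"
  shows "partitioned_forest F" "verts F \<noteq> {}"
  using assms by (auto simp: partitioned_tree_def)

lemma pforest_iso_via_sym:
  assumes F: "partitioned_forest F" and f: "pforest_iso_via f F G"
  shows "pforest_iso_via (inv_into (verts F) f) G F"
proof -
  let ?g = "inv_into (verts F) f"
  have b: "bij_betw f (verts F) (verts G)" using f by (simp add: pforest_iso_via_def)
  have inj: "inj_on f (verts F)" using b by (simp add: bij_betw_def)
  have g: "\<And>v. v \<in> verts G \<Longrightarrow> ?g v \<in> verts F \<and> f (?g v) = v"
    using b by (metis bij_betw_def f_inv_into_f inv_into_into)
  have "?g ` f ` B = B" if "B \<in> parts F" for B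
    using inj that partitioned_forestD(6)[OF F] by (intro inv_into_image_cancel) auto
  then have "image ?g ` image f ` parts F = parts F"
    by (simp add: image_image)
  then have "image ?g ` parts G = parts F"
    using f by (simp add: pforest_iso_via_def)
  moreover have "bij_betw ?g (verts G) (verts F)" using b by (rule bij_betw_inv_into)
  ultimately show ?thesis
    using f g by (auto simp: pforest_iso_via_def) metis+
qed

lemma pforest_iso_via_trans:
  assumes "pforest_iso_via f F G" "pforest_iso_via g G H"
  shows "pforest_iso_via (g \<circ> f) F H"
proof -
  have "f v \<in> verts G" if "v \<in> verts F" for v
    using assms(1) that by (auto simp: pforest_iso_via_def bij_betw_def)
  moreover have "image g ` image f ` parts F = parts H"
    using assms by (simp add: pforest_iso_via_def)
  then have "image (g \<circ> f) ` parts F = parts H"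
    by (simp add: image_image)
  ultimately show ?thesis
    using assms by (auto simp: pforest_iso_via_def intro: bij_betw_trans)
qed

lemma partitioned_tree_single_vertex: "partitioned_tree (single_vertex d)"
  by (auto simp: partitioned_tree_def partitioned_forest_def rooted_forest_def single_vertex_def
      roots_def partition_on_def single_valued_def acyclic_def)

lemma ptree_iso_refl: "partitioned_tree F \<Longrightarrow> ptree_iso F F"
  using pforest_iso_via_refl by (auto simp: ptree_iso_def)

lemma part_equivp_ptree_iso: "part_equivp (ptree_iso :: 'd pforest \<Rightarrow> _)"
proof (rule part_equivpI)
  show "\<exists>F :: 'd pforest. ptree_iso F F"
    by (rule exI, rule ptree_iso_refl, rule partitioned_tree_single_vertex)
  show "symp (ptree_iso :: 'd pforest \<Rightarrow> _)"
    unfolding symp_def ptree_iso_def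
    using pforest_iso_via_sym partitioned_treeD(1) by blast
  show "transp (ptree_iso :: 'd pforest \<Rightarrow> _)"
    unfolding transp_def ptree_iso_def using pforest_iso_via_trans by blast
qed

lemma roots_subset: "roots F \<subseteq> verts F"
  by (auto simp: roots_def)

lemma roots_nonempty:
  assumes "partitioned_forest F" "verts F \<noteq> {}"
  shows "roots F \<noteq> {}"
proof -
  note D = partitioned_forestD[OF assms(1)]
  have "finite (edges F)" using D(1,2) by (meson finite_SigmaI finite_subset)
  then have "wf ((edges F)\<inverse>)" using D(4) by (rule finite_acyclic_wf_converse)
  then obtain z where "z \<in> verts F" "\<And>y. (y, z) \<in> (edges F)\<inverse> \<Longrightarrow> y \<notin> verts F"
    using assms(2) by (metis ex_in_conv wfE_min)
  then have "z \<in> roots F" using D(2) by (auto simp: roots_def)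
  then show ?thesis by blast
qed

lemma roots_in_parts:
  assumes "partitioned_tree F"
  shows "roots F \<in> parts F"
proof -
  obtain B where B: "B \<in> parts F" "roots F \<subseteq> B" using assms by (auto simp: partitioned_tree_def)
  have F: "partitioned_forest F" using assms by (rule partitioned_treeD)
  obtain r where r: "r \<in> roots F" using roots_nonempty[OF F] assms by (auto dest: partitioned_treeD)
  have "v \<in> roots F" if "v \<in> B" for v
  proof -
    have "r \<in> B" using B r by blast
    then have "(v \<in> roots F \<and> r \<in> roots F) \<or> (\<exists>u. (v, u) \<in> edges F \<and> (r, u) \<in> edges F)"
      using F B(1) that unfolding partitioned_forest_def by blast
    then show ?thesis using r by (auto simp: roots_def)
  qed
  then show ?thesis using B by (metis subsetI subset_antisym)
qed

lemma part_eq_roots: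
  assumes "partitioned_tree F" "B \<in> parts F" "v \<in> B" "v \<in> roots F"
  shows "B = roots F"
proof (rule ccontr)
  assume "B \<noteq> roots F"
  then have "B \<inter> roots F = {}"
    using partitioned_forestD(5)[OF partitioned_treeD(1)[OF assms(1)]] roots_in_parts[OF assms(1)] assms(2)
    by (simp add: partition_on_def disjoint_def)
  then show False using assms(3,4) by blast
qed

lemma iso_roots:
  assumes "edges F \<subseteq> verts F \<times> verts F" "edges G \<subseteq> verts G \<times> verts G" "pforest_iso_via f F G"
  shows "f ` roots F = roots G"
proof -
  have b: "f ` verts F = verts G" and
    e: "\<And>v w. v \<in> verts F \<Longrightarrow> w \<in> verts F \<Longrightarrow> (v, w) \<in> edges F \<longleftrightarrow> (f v, f w) \<in> edges G"
    using assms(3) by (auto simp: pforest_iso_via_def bij_betw_def)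
  show ?thesis
  proof (intro equalityI subsetI)
    fix x assume "x \<in> f ` roots F"
    then obtain v where v: "x = f v" "v \<in> verts F" "\<And>w. (v, w) \<notin> edges F" by (auto simp: roots_def)
    then have "(x, y) \<notin> edges G" for y using e b assms(2) by (metis SigmaD2 imageE subsetD)
    then show "x \<in> roots G" using v b by (auto simp: roots_def)
  next
    fix x assume x: "x \<in> roots G"
    then obtain v where v: "x = f v" "v \<in> verts F" using b by (auto simp: roots_def)
    then have "(v, w) \<notin> edges F" for w using e x assms(1) by (auto simp: roots_def)
    then show "x \<in> f ` roots F" using v by (auto simp: roots_def)
  qed
qed

lemma emb_eq_iff: "emb i v = emb j w \<longleftrightarrow> i = j \<and> v = w"
  by simp

lemma verts_disjoint_union:
  "x \<in> verts (disjoint_union Fs) \<longleftrightarrow> (\<exists>i v. i < length Fs \<and> x = emb i v \<and> v \<in> verts (Fs ! i))"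
  by (auto simp: disjoint_union_def)

lemma edges_disjoint_union:
  "(x, y) \<in> edges (disjoint_union Fs) \<longleftrightarrow>
     (\<exists>i v w. i < length Fs \<and> x = emb i v \<and> y = emb i w \<and> (v, w) \<in> edges (Fs ! i))"
  by (force simp: disjoint_union_def)

lemma parts_disjoint_union:
  "B \<in> parts (disjoint_union Fs) \<longleftrightarrow> (\<exists>i C. i < length Fs \<and> B = emb i ` C \<and> C \<in> parts (Fs ! i))"
  by (auto simp: disjoint_union_def)

lemma dec_disjoint_union: "dec (disjoint_union Fs) (emb i v) = dec (Fs ! i) v"
  by (simp add: disjoint_union_def)

lemma roots_disjoint_union:
  "x \<in> roots (disjoint_union Fs) \<longleftrightarrow> (\<exists>i v. i < length Fs \<and> x = emb i v \<and> v \<in> roots (Fs ! i))"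
  by (auto simp: roots_def verts_disjoint_union edges_disjoint_union)

lemma finite_verts_disjoint_union:
  "(\<And>F. F \<in> set Fs \<Longrightarrow> finite (verts F)) \<Longrightarrow> finite (verts (disjoint_union Fs))"
  by (auto simp: disjoint_union_def)

lemma partition_on_disjoint_union:
  assumes "\<And>F. F \<in> set Fs \<Longrightarrow> partition_on (verts F) (parts F)"
  shows "partition_on (verts (disjoint_union Fs)) (parts (disjoint_union Fs))"
proof (rule partition_onI)
  have p: "partition_on (verts (Fs ! i)) (parts (Fs ! i))" if "i < length Fs" for i
    using assms that by simp
  show "\<Union> (parts (disjoint_union Fs)) = verts (disjoint_union Fs)"
  proof -
    have "\<Union> (parts (disjoint_union Fs)) = (\<Union>i<length Fs. emb i ` \<Union> (parts (Fs ! i)))"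
      by (auto simp: disjoint_union_def)
    then show ?thesis using p by (simp add: partition_on_def disjoint_union_def)
  qed
  show "{} \<notin> parts (disjoint_union Fs)"
    using p by (auto simp: parts_disjoint_union partition_on_def)
  fix A B assume AB: "A \<in> parts (disjoint_union Fs)" "B \<in> parts (disjoint_union Fs)" "A \<noteq> B"
  then obtain i C j D where *: "i < length Fs" "A = emb i ` C" "C \<in> parts (Fs ! i)"
    "j < length Fs" "B = emb j ` D" "D \<in> parts (Fs ! j)"
    unfolding parts_disjoint_union by blast
  show "disjnt A B"
  proof (cases "i = j")
    case True
    then have "C \<noteq> D" using * AB(3) by blast
    then have "C \<inter> D = {}" using * True p[of i] by (simp add: partition_on_def disjoint_def)
    then show ?thesis using * True by (auto simp: disjnt_def)
  qed (use * in \<open>auto simp: disjnt_def\<close>)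
qed

lemma disjoint_union_iso:
  assumes len: "length Fs = length Gs"
    and F: "\<And>i. i < length Fs \<Longrightarrow> partitioned_forest (Fs ! i)"
    and G: "\<And>i. i < length Fs \<Longrightarrow> partitioned_forest (Gs ! i)"
    and iso: "\<And>i. i < length Fs \<Longrightarrow> pforest_iso_via (f i) (Fs ! i) (Gs ! i)"
  shows "pforest_iso_via (\<lambda>x. case prod_decode x of (i, v) \<Rightarrow> emb i (f i v))
           (disjoint_union Fs) (disjoint_union Gs)" (is "pforest_iso_via ?h _ _")
  unfolding pforest_iso_via_def
proof (intro conjI ballI)
  have b: "\<And>i. i < length Fs \<Longrightarrow> f i ` verts (Fs ! i) = verts (Gs ! i) \<and> inj_on (f i) (verts (Fs ! i))"
    using iso by (auto simp: pforest_iso_via_def bij_betw_def)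
  show "bij_betw ?h (verts (disjoint_union Fs)) (verts (disjoint_union Gs))"
    unfolding bij_betw_def
  proof
    show "inj_on ?h (verts (disjoint_union Fs))"
      using b by (auto simp: inj_on_def verts_disjoint_union)
    show "?h ` verts (disjoint_union Fs) = verts (disjoint_union Gs)"
    proof (intro equalityI subsetI)
      fix x assume "x \<in> ?h ` verts (disjoint_union Fs)"
      then show "x \<in> verts (disjoint_union Gs)"
        using b len by (fastforce simp: verts_disjoint_union)
    next
      fix x assume "x \<in> verts (disjoint_union Gs)"
      then obtain i w where "i < length Fs" "x = emb i w" "w \<in> verts (Gs ! i)"
        using len by (auto simp: verts_disjoint_union)
      moreover then obtain v where "v \<in> verts (Fs ! i)" "w = f i v" using b by blast
      ultimately have "x = ?h (emb i v)" "emb i v \<in> verts (disjoint_union Fs)"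
        by (auto simp: verts_disjoint_union)
      then show "x \<in> ?h ` verts (disjoint_union Fs)" by blast
    qed
  qed
  show "image ?h ` parts (disjoint_union Fs) = parts (disjoint_union Gs)"
  proof -
    have "image ?h ` parts (disjoint_union Fs)
        = (\<Union>i<length Fs. (\<lambda>B. emb i ` f i ` B) ` parts (Fs ! i))"
      by (simp add: disjoint_union_def image_UN image_image)
    also have "\<dots> = (\<Union>i<length Fs. image (emb i) ` image (f i) ` parts (Fs ! i))"
      by (simp add: image_image)
    also have "\<dots> = parts (disjoint_union Gs)"
      using iso len by (simp add: disjoint_union_def pforest_iso_via_def)
    finally show ?thesis .
  qed
  fix x assume "x \<in> verts (disjoint_union Fs)"
  then obtain i v where x: "i < length Fs" "x = emb i v" "v \<in> verts (Fs ! i)"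
    by (auto simp: verts_disjoint_union)
  then show "dec (disjoint_union Gs) (?h x) = dec (disjoint_union Fs) x"
    using iso[of i] by (simp add: dec_disjoint_union pforest_iso_via_def)
  fix y assume "y \<in> verts (disjoint_union Fs)"
  then obtain j w where y: "j < length Fs" "y = emb j w" "w \<in> verts (Fs ! j)"
    by (auto simp: verts_disjoint_union)
  show "(x, y) \<in> edges (disjoint_union Fs) \<longleftrightarrow> (?h x, ?h y) \<in> edges (disjoint_union Gs)"
    using x y iso[of i] len by (auto simp: edges_disjoint_union pforest_iso_via_def)
qed

lemma verts_graft: "verts (graft F s Gs) = verts (disjoint_union (F # Gs))"
  and parts_graft: "parts (graft F s Gs) = parts (disjoint_union (F # Gs))"
  and dec_graft: "dec (graft F s Gs) = dec (disjoint_union (F # Gs))"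
  by (simp_all add: graft_def Let_def)

lemma edges_graft:
  "(x, y) \<in> edges (graft F s Gs) \<longleftrightarrow> (x, y) \<in> edges (disjoint_union (F # Gs)) \<or>
     (\<exists>i v. i < length Gs \<and> x = emb (Suc i) v \<and> y = emb 0 s \<and> v \<in> roots (Gs ! i))"
  by (auto simp: graft_def Let_def)

lemma roots_graft:
  assumes F: "edges F \<subseteq> verts F \<times> verts F"
  shows "roots (graft F s Gs) = emb 0 ` roots F"
proof (intro equalityI subsetI)
  fix x assume x: "x \<in> roots (graft F s Gs)"
  then have "x \<in> roots (disjoint_union (F # Gs))"
    by (auto simp: roots_def verts_graft edges_graft)
  then obtain i v where i: "i < length (F # Gs)" "x = emb i v" "v \<in> roots ((F # Gs) ! i)"
    by (auto simp: roots_disjoint_union)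
  show "x \<in> emb 0 ` roots F"
  proof (cases i)
    case (Suc j)
    then have "(x, emb 0 s) \<in> edges (graft F s Gs)" using i by (auto simp: edges_graft)
    then show ?thesis using x by (auto simp: roots_def)
  qed (use i in auto)
next
  fix x assume "x \<in> emb 0 ` roots F"
  then show "x \<in> roots (graft F s Gs)"
    by (auto simp: roots_def verts_graft edges_graft verts_disjoint_union edges_disjoint_union)
qed

lemma graft_trancl:
  assumes "(x, y) \<in> (edges (graft F s Gs))\<^sup>+"
  shows "(\<exists>i v w. i < length (F # Gs) \<and> x = emb i v \<and> y = emb i w \<and> (v, w) \<in> (edges ((F # Gs) ! i))\<^sup>+)
       \<or> (\<exists>i v w. x = emb (Suc i) v \<and> y = emb 0 w)"
  using assms
proof (induction rule: trancl_induct)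
  case (base y)
  then show ?case unfolding edges_graft edges_disjoint_union by blast
next
  case (step y z)
  from step.hyps(2) consider
      (a) i v w where "i < length (F # Gs)" "y = emb i v" "z = emb i w" "(v, w) \<in> edges ((F # Gs) ! i)"
    | (b) i v where "y = emb (Suc i) v" "z = emb 0 s"
    unfolding edges_graft edges_disjoint_union by blast
  then show ?case
  proof cases
    case a
    from step.IH show ?thesis
    proof (elim disjE exE conjE)
      fix j v' w' assume "j < length (F # Gs)" "x = emb j v'" "y = emb j w'"
        "(v', w') \<in> (edges ((F # Gs) ! j))\<^sup>+"
      then show ?thesis using a by (metis emb_eq_iff trancl.trancl_into_trancl)
    next
      fix j v' w' assume "x = emb (Suc j) v'" "y = emb 0 w'"
      then show ?thesis using a by (metis emb_eq_iff)
    qed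
  next
    case b
    with step.IH show ?thesis by (metis emb_eq_iff nat.distinct(1))
  qed
qed

lemma partitioned_tree_graft:
  assumes F: "partitioned_tree F" and s: "s \<in> verts F"
    and Gs: "\<And>G. G \<in> set Gs \<Longrightarrow> partitioned_tree G"
  shows "partitioned_tree (graft F s Gs)"
proof -
  let ?H = "graft F s Gs" and ?Fs = "F # Gs"
  have T: "partitioned_tree (?Fs ! i)" if "i < length ?Fs" for i
    using that F Gs by (metis nth_mem set_ConsD)
  note PF = partitioned_forestD[OF partitioned_treeD(1)[OF T]]
  have eF: "edges F \<subseteq> verts F \<times> verts F"
    using F partitioned_treeD(1) partitioned_forestD(2) by blast
  note rG = roots_graft[OF eF, of s Gs]
  have "finite (verts ?H)"
    unfolding verts_graft by (rule finite_verts_disjoint_union) (metis PF(1) in_set_conv_nth)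
  moreover have "(x, y) \<in> verts ?H \<times> verts ?H" if "(x, y) \<in> edges ?H" for x y
    using that
    unfolding edges_graft
  proof
    assume "(x, y) \<in> edges (disjoint_union ?Fs)"
    then show ?thesis unfolding verts_graft edges_disjoint_union mem_Sigma_iff verts_disjoint_union
      using PF(2) by blast
  next
    assume "\<exists>i v. i < length Gs \<and> x = emb (Suc i) v \<and> y = emb 0 s \<and> v \<in> roots (Gs ! i)"
    then obtain i v where "i < length Gs" "x = emb (Suc i) v" "y = emb 0 s" "v \<in> roots (Gs ! i)"
      by blast
    then show ?thesis using s roots_subset[of "Gs ! i"]
      by (auto simp: verts_graft verts_disjoint_union)
  qed
  moreover have "single_valued (edges ?H)"
  proof (rule single_valuedI)
    fix x y z assume "(x, y) \<in> edges ?H" "(x, z) \<in> edges ?H"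
    then show "y = z"
      unfolding edges_graft edges_disjoint_union
    proof (elim disjE exE conjE)
      fix i v w i' v' w'
      assume "i < length ?Fs" "x = emb i v" "y = emb i w" "(v, w) \<in> edges (?Fs ! i)"
        "i' < length ?Fs" "x = emb i' v'" "z = emb i' w'" "(v', w') \<in> edges (?Fs ! i')"
      then show ?thesis using PF(3)[of i] by (auto dest: single_valuedD)
    qed (auto simp: roots_def)
  qed
  moreover have "acyclic (edges ?H)"
  proof (rule acyclicI, intro allI notI)
    fix x assume "(x, x) \<in> (edges ?H)\<^sup>+"
    from graft_trancl[OF this] show False
      using PF(4) by (auto simp: acyclic_def)
  qed
  moreover have "partition_on (verts ?H) (parts ?H)"
    unfolding verts_graft parts_graft
    by (rule partition_on_disjoint_union) (metis PF(5) in_set_conv_nth)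
  moreover have "(v \<in> roots ?H \<and> w \<in> roots ?H) \<or> (\<exists>u. (v, u) \<in> edges ?H \<and> (w, u) \<in> edges ?H)"
    if B: "B \<in> parts ?H" "v \<in> B" "w \<in> B" for B v w
  proof -
    obtain i C v' w' where *: "i < length ?Fs" "B = emb i ` C" "C \<in> parts (?Fs ! i)"
      "v = emb i v'" "w = emb i w'" "v' \<in> C" "w' \<in> C"
      using B unfolding parts_graft parts_disjoint_union by blast
    have "(v' \<in> roots (?Fs ! i) \<and> w' \<in> roots (?Fs ! i)) \<or>
          (\<exists>u. (v', u) \<in> edges (?Fs ! i) \<and> (w', u) \<in> edges (?Fs ! i))"
      using partitioned_treeD(1)[OF T[OF *(1)]] * unfolding partitioned_forest_def by blast
    then show ?thesis
    proof (elim disjE exE)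
      assume r: "v' \<in> roots (?Fs ! i) \<and> w' \<in> roots (?Fs ! i)"
      show ?thesis
      proof (cases i)
        case 0
        then show ?thesis using r * rG by auto
      next
        case (Suc j)
        then show ?thesis using r * by (auto simp: edges_graft)
      qed
    next
      fix u assume "(v', u) \<in> edges (?Fs ! i) \<and> (w', u) \<in> edges (?Fs ! i)"
      then have "(v, emb i u) \<in> edges ?H" "(w, emb i u) \<in> edges ?H"
        unfolding edges_graft edges_disjoint_union using * by blast+
      then show ?thesis by blast
    qed
  qed
  moreover have "verts ?H \<noteq> {}" using s by (force simp: verts_graft verts_disjoint_union)
  moreover have "emb 0 ` roots F \<in> parts ?H"
    unfolding parts_graft parts_disjoint_union using roots_in_parts[OF F]
    by (intro exI[of _ 0] exI[of _ "roots F"]) auto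
  ultimately show ?thesis
    unfolding partitioned_tree_def partitioned_forest_def rooted_forest_def
    using rG by (intro conjI ballI subrelI bexI[of _ "emb 0 ` roots F"]) simp_all
qed

lemma graft_iso:
  assumes F: "partitioned_tree F" "partitioned_tree F'" "pforest_iso_via f F F'" and s: "s \<in> verts F"
    and Gs: "list_all2 ptree_iso Gs Gs'"
  shows "ptree_iso (graft F s Gs) (graft F' (f s) Gs')"
proof -
  have len: "length Gs = length Gs'" using Gs by (rule list_all2_lengthD)
  have Gi: "partitioned_tree (Gs ! i)" "partitioned_tree (Gs' ! i)"
    "\<exists>g. pforest_iso_via g (Gs ! i) (Gs' ! i)" if "i < length Gs" for i
    using list_all2_nthD[OF Gs that] by (auto simp: ptree_iso_def)
  obtain g where g: "\<And>i. i < length Gs \<Longrightarrow> pforest_iso_via (g i) (Gs ! i) (Gs' ! i)"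
    using Gi(3) by metis
  define h where "h i = (case i of 0 \<Rightarrow> f | Suc j \<Rightarrow> g j)" for i
  define k where "k = (\<lambda>x. case prod_decode x of (i, v) \<Rightarrow> emb i (h i v))"
  have T: "partitioned_tree ((F # Gs) ! i)" "partitioned_tree ((F' # Gs') ! i)"
    "pforest_iso_via (h i) ((F # Gs) ! i) ((F' # Gs') ! i)" if "i < length (F # Gs)" for i
    using that F Gi g by (cases i; simp add: h_def)+
  have k: "pforest_iso_via k (disjoint_union (F # Gs)) (disjoint_union (F' # Gs'))"
    unfolding k_def by (rule disjoint_union_iso) (use len T partitioned_treeD(1) in auto)
  have fs: "f s \<in> verts F'" using F s by (auto simp: pforest_iso_via_def bij_betw_def)
  have attach: "(\<exists>i v. i < length Gs \<and> x = emb (Suc i) v \<and> y = emb 0 s \<and> v \<in> roots (Gs ! i)) \<longleftrightarrow>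
      (\<exists>i v. i < length Gs' \<and> k x = emb (Suc i) v \<and> k y = emb 0 (f s) \<and> v \<in> roots (Gs' ! i))"
    if xy: "x \<in> verts (disjoint_union (F # Gs))" "y \<in> verts (disjoint_union (F # Gs))" for x y
  proof -
    obtain i v where x: "i < length (F # Gs)" "x = emb i v" "v \<in> verts ((F # Gs) ! i)"
      using xy(1) unfolding verts_disjoint_union by blast
    obtain j w where y: "j < length (F # Gs)" "y = emb j w" "w \<in> verts ((F # Gs) ! j)"
      using xy(2) unfolding verts_disjoint_union by blast
    have r: "g i ` roots (Gs ! i) = roots (Gs' ! i)" if "i < length Gs" for i
      using iso_roots[OF _ _ g[OF that]] Gi[OF that] partitioned_treeD(1) partitioned_forestD(2) by blast
    have inj: "inj_on (g i) (verts (Gs ! i))" if "i < length Gs" for i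
      using g[OF that] by (simp add: pforest_iso_via_def bij_betw_def)
    have r': "g i v \<in> roots (Gs' ! i) \<longleftrightarrow> v \<in> roots (Gs ! i)" if "i < length Gs" "v \<in> verts (Gs ! i)" for i v
      using r[OF that(1)] inj[OF that(1)] that(2) roots_subset[of "Gs ! i"]
      by (metis inj_on_image_mem_iff)
    have injf: "f w = f s \<longleftrightarrow> w = s" if "w \<in> verts F"
      using F(3) that s by (auto simp: pforest_iso_via_def bij_betw_def inj_on_def)
    show ?thesis
      using x y r' injf len by (cases i; cases j) (auto simp: k_def h_def)
  qed
  have "pforest_iso_via k (graft F s Gs) (graft F' (f s) Gs')"
    unfolding pforest_iso_via_def
  proof (intro conjI ballI)
    fix v w assume vw: "v \<in> verts (graft F s Gs)" "w \<in> verts (graft F s Gs)"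
    then have "(v, w) \<in> edges (disjoint_union (F # Gs)) \<longleftrightarrow> (k v, k w) \<in> edges (disjoint_union (F' # Gs'))"
      using k by (simp add: pforest_iso_via_def verts_graft)
    then show "(v, w) \<in> edges (graft F s Gs) \<longleftrightarrow> (k v, k w) \<in> edges (graft F' (f s) Gs')"
      using attach vw unfolding edges_graft verts_graft by simp
  qed (use k in \<open>auto simp: pforest_iso_via_def verts_graft parts_graft dec_graft\<close>)
  moreover have "partitioned_tree (graft F s Gs)"
    using F s Gi by (intro partitioned_tree_graft) (auto simp: in_set_conv_nth)
  moreover have "partitioned_tree (graft F' (f s) Gs')"
    using F fs Gi len by (intro partitioned_tree_graft) (auto simp: in_set_conv_nth)
  ultimately show ?thesis unfolding ptree_iso_def by blast
qed

lemma verts_merge: "verts (merge F G) = verts (disjoint_union [F, G])"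
  and edges_merge: "edges (merge F G) = edges (disjoint_union [F, G])"
  and dec_merge: "dec (merge F G) = dec (disjoint_union [F, G])"
  and parts_merge: "parts (merge F G) =
    parts (disjoint_union [F, G]) - {emb 0 ` roots F, emb 1 ` roots G} \<union> {emb 0 ` roots F \<union> emb 1 ` roots G}"
  and roots_merge: "roots (merge F G) = emb 0 ` roots F \<union> emb 1 ` roots G"
proof -
  show v: "verts (merge F G) = verts (disjoint_union [F, G])"
    and e: "edges (merge F G) = edges (disjoint_union [F, G])"
    and "dec (merge F G) = dec (disjoint_union [F, G])"
    and "parts (merge F G) =
      parts (disjoint_union [F, G]) - {emb 0 ` roots F, emb 1 ` roots G} \<union> {emb 0 ` roots F \<union> emb 1 ` roots G}"
    by (simp_all add: merge_def Let_def)
  have "roots (merge F G) = roots (disjoint_union [F, G])"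
    by (simp add: roots_def v e)
  also have "\<dots> = emb 0 ` roots F \<union> emb 1 ` roots G"
    by (auto simp: roots_disjoint_union less_Suc_eq)
  finally show "roots (merge F G) = emb 0 ` roots F \<union> emb 1 ` roots G" .
qed

lemma disjoint_union_trancl:
  assumes "(x, y) \<in> (edges (disjoint_union Fs))\<^sup>+"
  shows "\<exists>i v w. i < length Fs \<and> x = emb i v \<and> y = emb i w \<and> (v, w) \<in> (edges (Fs ! i))\<^sup>+"
  using assms
proof (induction rule: trancl_induct)
  case (base y)
  then show ?case unfolding edges_disjoint_union by blast
next
  case (step y z)
  then show ?case unfolding edges_disjoint_union
    by (metis emb_eq_iff trancl.trancl_into_trancl)
qed

lemma partitioned_forest_disjoint_union:
  assumes Fs: "\<And>F. F \<in> set Fs \<Longrightarrow> partitioned_forest F"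
  shows "partitioned_forest (disjoint_union Fs)"
proof -
  let ?H = "disjoint_union Fs"
  have T: "partitioned_forest (Fs ! i)" if "i < length Fs" for i
    using that Fs by simp
  note PF = partitioned_forestD[OF T]
  have "finite (verts ?H)"
    by (rule finite_verts_disjoint_union) (metis PF(1) in_set_conv_nth)
  moreover have "edges ?H \<subseteq> verts ?H \<times> verts ?H"
    unfolding subset_iff split_paired_All edges_disjoint_union mem_Sigma_iff verts_disjoint_union
    using PF(2) by blast
  moreover have "single_valued (edges ?H)"
    by (rule single_valuedI) (use PF(3) in \<open>auto simp: edges_disjoint_union single_valued_def\<close>)
  moreover have "acyclic (edges ?H)"
    by (rule acyclicI) (use PF(4) in \<open>auto dest!: disjoint_union_trancl simp: acyclic_def\<close>)
  moreover have "partition_on (verts ?H) (parts ?H)"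
    by (rule partition_on_disjoint_union) (metis PF(5) in_set_conv_nth)
  moreover have "(v \<in> roots ?H \<and> w \<in> roots ?H) \<or> (\<exists>u. (v, u) \<in> edges ?H \<and> (w, u) \<in> edges ?H)"
    if B: "B \<in> parts ?H" "v \<in> B" "w \<in> B" for B v w
  proof -
    obtain i C v' w' where *: "i < length Fs" "B = emb i ` C" "C \<in> parts (Fs ! i)"
      "v = emb i v'" "w = emb i w'" "v' \<in> C" "w' \<in> C"
      using B unfolding parts_disjoint_union by blast
    have "(v' \<in> roots (Fs ! i) \<and> w' \<in> roots (Fs ! i)) \<or>
          (\<exists>u. (v', u) \<in> edges (Fs ! i) \<and> (w', u) \<in> edges (Fs ! i))"
      using T[OF *(1)] * unfolding partitioned_forest_def by blast
    then show ?thesis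
      unfolding roots_disjoint_union edges_disjoint_union using * by blast
  qed
  ultimately show ?thesis
    unfolding partitioned_forest_def rooted_forest_def by blast
qed

lemma partition_on_merge_parts:
  assumes P: "partition_on V P" and RS: "R \<in> P" "S \<in> P"
  shows "partition_on V (P - {R, S} \<union> {R \<union> S})"
proof (rule partition_onI)
  have p: "\<Union> P = V" "{} \<notin> P" "\<And>A B. A \<in> P \<Longrightarrow> B \<in> P \<Longrightarrow> A \<noteq> B \<Longrightarrow> A \<inter> B = {}"
    using P by (simp_all add: partition_on_def disjoint_def)
  show "\<Union> (P - {R, S} \<union> {R \<union> S}) = V" using p(1) RS by auto
  show "{} \<notin> P - {R, S} \<union> {R \<union> S}" using p(2) RS by auto
  have d: "A \<inter> (R \<union> S) = {}" if "A \<in> P - {R, S}" for A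
    using that p(3)[of A R] p(3)[of A S] RS by auto
  fix A B assume AB: "A \<in> P - {R, S} \<union> {R \<union> S}" "B \<in> P - {R, S} \<union> {R \<union> S}" "A \<noteq> B"
  show "disjnt A B"
  proof (cases "A = R \<union> S")
    case True
    then have "B \<in> P - {R, S}" using AB by auto
    then show ?thesis using d True by (auto simp: disjnt_def)
  next
    case A: False
    then have A': "A \<in> P - {R, S}" using AB by auto
    show ?thesis
    proof (cases "B = R \<union> S")
      case True
      then show ?thesis using d[OF A'] by (simp add: disjnt_def)
    next
      case False
      then show ?thesis using AB A' p(3)[of A B] by (auto simp: disjnt_def)
    qed
  qed
qed

lemma partitioned_tree_merge:
  assumes F: "partitioned_tree F" and G: "partitioned_tree G"
  shows "partitioned_tree (merge F G)"
proof -
  let ?U = "disjoint_union [F, G]" and ?H = "merge F G"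
  let ?R = "emb 0 ` roots F" and ?S = "emb 1 ` roots G"
  have U: "partitioned_forest ?U"
    using F G by (auto intro!: partitioned_forest_disjoint_union dest: partitioned_treeD)
  have R: "?R \<in> parts ?U" unfolding parts_disjoint_union
    using roots_in_parts[OF F] by (intro exI[of _ 0] exI[of _ "roots F"]) auto
  have S: "?S \<in> parts ?U" unfolding parts_disjoint_union
    using roots_in_parts[OF G] by (intro exI[of _ 1] exI[of _ "roots G"]) auto
  have rH: "roots ?H = roots ?U" by (simp add: roots_def verts_merge edges_merge)
  have "rooted_forest ?H"
    using U by (simp add: partitioned_forest_def rooted_forest_def verts_merge edges_merge)
  moreover have "partition_on (verts ?H) (parts ?H)"
    unfolding verts_merge parts_merge
    by (rule partition_on_merge_parts[OF partitioned_forestD(5)[OF U] R S])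
  moreover have "(v \<in> roots ?H \<and> w \<in> roots ?H) \<or> (\<exists>u. (v, u) \<in> edges ?H \<and> (w, u) \<in> edges ?H)"
    if "B \<in> parts ?H" "v \<in> B" "w \<in> B" for B v w
  proof (cases "B = ?R \<union> ?S")
    case True
    then show ?thesis using that roots_merge[of F G] by simp
  next
    case False
    then have "B \<in> parts ?U" using that by (simp add: parts_merge)
    then show ?thesis using U that unfolding rH edges_merge partitioned_forest_def by blast
  qed
  moreover have "verts ?H \<noteq> {}"
    using partitioned_treeD(2)[OF F] by (force simp: verts_merge verts_disjoint_union)
  moreover have "roots ?H \<in> parts ?H" by (simp add: parts_merge roots_merge)
  ultimately show ?thesis unfolding partitioned_tree_def partitioned_forest_def by blast
qed

lemma merge_iso:
  assumes "ptree_iso F F'" "ptree_iso G G'"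
  shows "ptree_iso (merge F G) (merge F' G')"
proof -
  obtain f g where T: "partitioned_tree F" "partitioned_tree F'" "pforest_iso_via f F F'"
    "partitioned_tree G" "partitioned_tree G'" "pforest_iso_via g G G'"
    using assms by (auto simp: ptree_iso_def)
  define h where "h i = (if i = 0 then f else g)" for i :: nat
  define k where "k = (\<lambda>x. case prod_decode x of (i, v) \<Rightarrow> emb i (h i v))"
  have U: "partitioned_forest (disjoint_union [F, G])"
    using T by (auto intro!: partitioned_forest_disjoint_union dest: partitioned_treeD)
  have k: "pforest_iso_via k (disjoint_union [F, G]) (disjoint_union [F', G'])"
    unfolding k_def
    by (rule disjoint_union_iso) (use T partitioned_treeD(1) in \<open>auto simp: less_Suc_eq h_def\<close>)
  have "f ` roots F = roots F'" "g ` roots G = roots G'"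
    using T iso_roots partitioned_treeD(1) partitioned_forestD(2) by blast+
  then have kR: "k ` emb 0 ` roots F = emb 0 ` roots F'" and kS: "k ` emb 1 ` roots G = emb 1 ` roots G'"
    by (auto simp: k_def h_def image_image simp flip: \<open>f ` roots F = roots F'\<close> \<open>g ` roots G = roots G'\<close>)
  have R: "emb 0 ` roots F \<in> parts (disjoint_union [F, G])" unfolding parts_disjoint_union
    using roots_in_parts[OF T(1)] by (intro exI[of _ 0] exI[of _ "roots F"]) auto
  have S: "emb 1 ` roots G \<in> parts (disjoint_union [F, G])" unfolding parts_disjoint_union
    using roots_in_parts[OF T(4)] by (intro exI[of _ 1] exI[of _ "roots G"]) auto
  have "inj_on k (verts (disjoint_union [F, G]))" using k by (simp add: pforest_iso_via_def bij_betw_def)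
  then have "inj_on (image k) (parts (disjoint_union [F, G]))"
    using partitioned_forestD(6)[OF U] by (metis inj_on_image)
  then have "image k ` (parts (disjoint_union [F, G]) - {emb 0 ` roots F, emb 1 ` roots G})
      = image k ` parts (disjoint_union [F, G]) - image k ` {emb 0 ` roots F, emb 1 ` roots G}"
    using R S by (intro inj_on_image_set_diff[where C = "parts (disjoint_union [F, G])"]) auto
  then have "image k ` parts (merge F G) = parts (merge F' G')"
    using k unfolding parts_merge
    by (simp only: image_Un image_insert image_empty kR kS pforest_iso_via_def)
  then have "pforest_iso_via k (merge F G) (merge F' G')"
    using k by (simp add: pforest_iso_via_def verts_merge edges_merge dec_merge)
  then show ?thesis using T partitioned_tree_merge by (auto simp: ptree_iso_def)
qed


section \<open>The Com-Prelie algebra of partitioned trees\<close>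

quotient_type 'd ptree = "'d pforest" / partial: ptree_iso
  by (rule part_equivp_ptree_iso)

lift_definition dot :: "'d \<Rightarrow> 'd ptree" is single_vertex
  by (rule ptree_iso_refl[OF partitioned_tree_single_vertex])

text \<open>\<open>brace d [t\<^sub>1, \<dots>, t\<^sub>k]\<close> is the partitioned tree written \<open>\<cdot>\<^sub>d \<bullet> t\<^sub>1 \<dots> t\<^sub>k\<close>.\<close>

lift_definition brace :: "'d \<Rightarrow> 'd ptree list \<Rightarrow> 'd ptree"
  is "\<lambda>d Gs. graft (single_vertex d) 0 Gs"
proof -
  fix d :: 'd and Gs Gs' :: "'d pforest list" assume "list_all2 ptree_iso Gs Gs'"
  then have "ptree_iso (graft (single_vertex d) 0 Gs) (graft (single_vertex d) (id 0) Gs')"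
    by (intro graft_iso partitioned_tree_single_vertex pforest_iso_via_refl)
      (simp_all add: single_vertex_def)
  then show "ptree_iso (graft (single_vertex d) 0 Gs) (graft (single_vertex d) 0 Gs')" by simp
qed

lift_definition sqcup_tree :: "'d ptree \<Rightarrow> 'd ptree \<Rightarrow> 'd ptree" is merge
  by (rule merge_iso)

lift_definition bullet_tree :: "'d ptree \<Rightarrow> 'd ptree \<Rightarrow> ('d ptree \<Rightarrow>\<^sub>0 'k::field)"
  is "\<lambda>F G. \<Sum>s\<in>verts F. basis (abs_ptree (graft F s [G]))"
proof -
  fix F F' G G' :: "'d pforest"
  assume *: "ptree_iso F F'" "ptree_iso G G'"
  then obtain f where f: "partitioned_tree F" "partitioned_tree F'" "pforest_iso_via f F F'"
    by (auto simp: ptree_iso_def)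
  then have b: "bij_betw f (verts F) (verts F')" by (simp add: pforest_iso_via_def)
  have "(basis (abs_ptree (graft F s [G])) :: _ \<Rightarrow>\<^sub>0 'k) = basis (abs_ptree (graft F' (f s) [G']))"
    if "s \<in> verts F" for s
  proof -
    have "ptree_iso (graft F s [G]) (graft F' (f s) [G'])" using graft_iso[OF f that] * by simp
    then show ?thesis using Quotient_rel_abs[OF Quotient_ptree] by metis
  qed
  then show "(\<Sum>s\<in>verts F. basis (abs_ptree (graft F s [G])) :: _ \<Rightarrow>\<^sub>0 'k) =
      (\<Sum>s\<in>verts F'. basis (abs_ptree (graft F' s [G'])))"
    unfolding sum.reindex_bij_betw[OF b, symmetric] by (rule sum.cong[OF refl])
qed

definition pt_bullet :: "('d ptree \<Rightarrow>\<^sub>0 'k::field) \<Rightarrow> ('d ptree \<Rightarrow>\<^sub>0 'k) \<Rightarrow> ('d ptree \<Rightarrow>\<^sub>0 'k)" where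
  "pt_bullet = bilinear_ext bullet_tree"

definition pt_sqcup :: "('d ptree \<Rightarrow>\<^sub>0 'k::field) \<Rightarrow> ('d ptree \<Rightarrow>\<^sub>0 'k) \<Rightarrow> ('d ptree \<Rightarrow>\<^sub>0 'k)" where
  "pt_sqcup = bilinear_ext (\<lambda>t t'. basis (sqcup_tree t t'))"


section \<open>The Com-Prelie algebra of words\<close>

datatype letter = X0 | X1

definition prepend :: "letter \<Rightarrow> (letter list \<Rightarrow>\<^sub>0 'k::field) \<Rightarrow> (letter list \<Rightarrow>\<^sub>0 'k)" where
  "prepend a = linear_ext (\<lambda>w. basis (a # w))"

fun shuffle_words :: "letter list \<Rightarrow> letter list \<Rightarrow> (letter list \<Rightarrow>\<^sub>0 'k::field)" where
  "shuffle_words [] w = basis w"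
| "shuffle_words (a # v) [] = basis (a # v)"
| "shuffle_words (a # v) (b # w) =
     prepend a (shuffle_words v (b # w)) + prepend b (shuffle_words (a # v) w)"

fun bullet_words :: "letter list \<Rightarrow> letter list \<Rightarrow> (letter list \<Rightarrow>\<^sub>0 'k::field)" where
  "bullet_words [] d = 0"
| "bullet_words (X0 # c) d = prepend X0 (bullet_words c d)"
| "bullet_words (X1 # c) d = prepend X1 (bullet_words c d) + prepend X0 (shuffle_words c d)"

definition word_sqcup :: "(letter list \<Rightarrow>\<^sub>0 'k::field) \<Rightarrow> (letter list \<Rightarrow>\<^sub>0 'k) \<Rightarrow> (letter list \<Rightarrow>\<^sub>0 'k)" where
  "word_sqcup = bilinear_ext shuffle_words"

definition word_bullet :: "(letter list \<Rightarrow>\<^sub>0 'k::field) \<Rightarrow> (letter list \<Rightarrow>\<^sub>0 'k) \<Rightarrow> (letter list \<Rightarrow>\<^sub>0 'k)" where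
  "word_bullet = bilinear_ext bullet_words"


section \<open>The relations\<close>

text \<open>\<open>L1\<close> and \<open>L2\<close> stand for the decorations \<open>1\<close> and \<open>2\<close>.\<close>

datatype label = L1 | L2

definition CPL_relations :: "(label ptree \<Rightarrow>\<^sub>0 'k::field_char_0) set" where
  "CPL_relations =
     {basis (brace L1 ts) | ts. length ts \<ge> 1} \<union>
     {basis (brace L2 ts) | ts. length ts \<ge> 2} \<union>
     {pt_sqcup (basis (dot L1)) (basis t) - basis t | t. True} \<union>
     {pt_sqcup (pt_bullet (basis (dot L2)) (basis t)) (pt_bullet (basis (dot L2)) (basis t'))
        - pt_bullet (basis (dot L2))
            (pt_sqcup (pt_bullet (basis (dot L2)) (basis t)) (basis t')
             + pt_sqcup (basis t) (pt_bullet (basis (dot L2)) (basis t'))) | t t'. True}"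

end

theory Submission
  imports Defs
begin

text \<open>Since \<open>\<cdot>\<^sub>d \<bullet> t\<^sub>1 \<dots> t\<^sub>k t = (\<cdot>\<^sub>d \<bullet> t\<^sub>1 \<dots> t\<^sub>k) \<bullet> t - \<Sum>\<^sub>i \<cdot>\<^sub>d \<bullet> t\<^sub>1 \<dots> (t\<^sub>i \<bullet> t) \<dots> t\<^sub>k\<close>,
  an induction on \<open>k\<close> shows that the relations lie in the kernel. Conversely, a partitioned tree
  is a \<open>\<squnion>\<squnion>\<close>-product of trees \<open>\<cdot>\<^sub>d \<bullet> t\<^sub>1 \<dots> t\<^sub>k\<close>, so modulo the relations every element
  is a combination of the trees obtained from the unit \<open>\<cdot>\<^sub>1\<close> by iterating
  \<open>\<cdot>\<^sub>2 \<bullet> _\<close> and \<open>\<cdot>\<^sub>2 \<squnion>\<squnion> _\<close>. These trees are indexed by words in \<open>x\<^sub>0, x\<^sub>1\<close>; their images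
  are obtained from the empty word by iterating \<open>x\<^sub>0 _\<close> and \<open>x\<^sub>1 \<squnion>\<squnion> _\<close>, and the
  lexicographically largest word of such an image is the index itself, with a positive integer
  coefficient. In characteristic zero the images are therefore linearly independent, and the
  kernel contains nothing but the ideal.\<close>

section \<open>Linear extensions and ideals\<close>

text \<open>Reduces the multilinear identities below to basis vectors. An update at a key outside
  the support adds a multiple of a basis vector.\<close>

lemma basis_induct [case_names basis add scale]:
  fixes p :: "'a \<Rightarrow>\<^sub>0 'k::field"
  assumes b: "\<And>a. P (basis a)" and a: "\<And>p q. P p \<Longrightarrow> P q \<Longrightarrow> P (p + q)"
    and s: "\<And>c p. P p \<Longrightarrow> P (scale c p)"
  shows "P p"
proof (induction p rule: Poly_Mapping.update_induct)
  case const
  \<comment> \<open>The zero vector arises as zero times an arbitrary basis vector.\<close>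
  have "P (scale 0 (basis undefined))" using b s by blast
  then show ?case by simp
next
  case (update f a c)
  have "Poly_Mapping.update a c f = f + scale c (basis a)"
    using update(1) by (intro poly_mapping_eqI)
      (auto simp: lookup_add lookup_update basis_def lookup_single in_keys_iff when_def)
  then show ?case using b a s update by metis
qed

lemma keys_basis [simp]: "Poly_Mapping.keys (basis a :: 'a \<Rightarrow>\<^sub>0 'k::field) = {a}"
  by (simp add: basis_def)

lemma lookup_basis: "Poly_Mapping.lookup (basis a :: 'a \<Rightarrow>\<^sub>0 'k::field) b = (if a = b then 1 else 0)"
  by (simp add: basis_def lookup_single when_def)

text \<open>The supports of \<open>p\<close>, \<open>q\<close> and \<open>p + q\<close> differ; a
  common finite index set makes the three sums comparable.\<close>

lemma linear_ext_superset:
  assumes "finite S" "Poly_Mapping.keys p \<subseteq> S"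
  shows "linear_ext f p = (\<Sum>a\<in>S. scale (Poly_Mapping.lookup p a) (f a))"
  unfolding linear_ext_def using assms
  by (intro sum.mono_neutral_left) (auto simp: in_keys_iff)

lemma linear_ext_basis [simp]: "linear_ext f (basis a) = f a"
  by (simp add: linear_ext_def lookup_basis)

lemma linear_ext_add: "linear_ext f (p + q) = linear_ext f p + linear_ext f q"
proof -
  let ?S = "Poly_Mapping.keys p \<union> Poly_Mapping.keys q"
  have "Poly_Mapping.keys (p + q) \<subseteq> ?S" by (rule keys_add)
  then show ?thesis
    by (simp add: linear_ext_superset[of ?S] lookup_add free_vs.scale_left_distrib sum.distrib)
qed

lemma linear_ext_scale: "linear_ext f (scale c p) = scale c (linear_ext f p)"
proof -
  have "Poly_Mapping.keys (scale c p) \<subseteq> Poly_Mapping.keys p" by (auto simp: in_keys_iff)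
  then show ?thesis
    by (simp add: linear_ext_superset[of "Poly_Mapping.keys p"] free_vs.scale_sum_right)
qed

lemma linear_linear_ext: "Vector_Spaces.linear scale scale (linear_ext f)"
  by unfold_locales (auto simp: linear_ext_add linear_ext_scale)

lemma linear_image_linear_ext:
  assumes "Vector_Spaces.linear scale scale h"
  shows "h (linear_ext f p) = linear_ext (\<lambda>a. h (f a)) p"
proof -
  interpret h: Vector_Spaces.linear scale scale h by fact
  show ?thesis by (simp add: linear_ext_def h.sum h.scale)
qed

lemma linear_ext_zero_fun: "linear_ext (\<lambda>_. 0) p = 0"
  by (simp add: linear_ext_def)

lemma linear_ext_add_fun: "linear_ext (\<lambda>a. f a + g a) p = linear_ext f p + linear_ext g p"
  by (simp add: linear_ext_def free_vs.scale_right_distrib sum.distrib)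

lemma linear_ext_scale_fun: "linear_ext (\<lambda>a. scale c (f a)) p = scale c (linear_ext f p)"
  by (simp add: linear_ext_def free_vs.scale_sum_right mult.commute)

lemma bilinear_ext_altdef: "bilinear_ext f p q = linear_ext (\<lambda>a. linear_ext (f a) q) p"
  by (simp add: bilinear_ext_def linear_ext_def free_vs.scale_sum_right)

lemma bilinear_ext_simps:
  "bilinear_ext f (p + p') q = bilinear_ext f p q + bilinear_ext f p' q"
  "bilinear_ext f p (q + q') = bilinear_ext f p q + bilinear_ext f p q'"
  "bilinear_ext f (scale c p) q = scale c (bilinear_ext f p q)"
  "bilinear_ext f p (scale c q) = scale c (bilinear_ext f p q)"
  "bilinear_ext f (basis a) (basis b) = f a b"
  by (simp_all add: bilinear_ext_altdef linear_ext_add linear_ext_scale linear_ext_add_fun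
      linear_ext_scale_fun)

lemma bilinear_ext_zero [simp]: "bilinear_ext f 0 q = 0" "bilinear_ext f p 0 = 0"
  by (simp_all add: bilinear_ext_def)

section \<open>Generated ideals and kernels of morphisms\<close>

lemma com_prelie_ideal_ideal_generated:
  assumes "module s"
  shows "com_prelie_ideal s b m (com_prelie_ideal_generated s b m S)"
  unfolding com_prelie_ideal_def com_prelie_ideal_generated_def
  using module.subspace_Inter[OF assms, of "{I. com_prelie_ideal s b m I \<and> S \<subseteq> I}"]
  by (auto simp: com_prelie_ideal_def)

lemma subset_com_prelie_ideal_generated: "S \<subseteq> com_prelie_ideal_generated s b m S"
  by (auto simp: com_prelie_ideal_generated_def)

lemma com_prelie_ideal_generated_subset:
  "com_prelie_ideal s b m I \<Longrightarrow> S \<subseteq> I \<Longrightarrow> com_prelie_ideal_generated s b m S \<subseteq> I"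
  by (auto simp: com_prelie_ideal_generated_def)

text \<open>The three conditions on zero match the three products in the definition of an ideal,
  which multiplies by \<open>m\<close> on one side only.\<close>

lemma com_prelie_ideal_kernel:
  assumes "com_prelie_hom s b m s' b' m' \<phi>"
    and "\<And>y. b' 0 y = 0" "\<And>y. b' y 0 = 0" "\<And>y. m' 0 y = 0"
  shows "com_prelie_ideal s b m {p. \<phi> p = 0}"
proof -
  interpret h: Vector_Spaces.linear s s' \<phi> using assms(1) by (simp add: com_prelie_hom_def)
  show ?thesis
    using assms h.subspace_kernel by (simp add: com_prelie_ideal_def com_prelie_hom_def)
qed

section \<open>Words\<close>

lemma prepend_simps:
  "prepend x (basis w) = basis (x # w)"
  "prepend x (p + q) = prepend x p + prepend x q"
  "prepend x (scale c p) = scale c (prepend x p)"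
  by (simp_all add: prepend_def linear_ext_add linear_ext_scale)

lemma word_sqcup_simps:
  "word_sqcup (p + p') q = word_sqcup p q + word_sqcup p' q"
  "word_sqcup p (q + q') = word_sqcup p q + word_sqcup p q'"
  "word_sqcup (scale c p) q = scale c (word_sqcup p q)"
  "word_sqcup p (scale c q) = scale c (word_sqcup p q)"
  "word_sqcup (basis v) (basis w) = shuffle_words v w"
  by (simp_all add: word_sqcup_def bilinear_ext_simps)

lemma word_bullet_simps:
  "word_bullet (p + p') q = word_bullet p q + word_bullet p' q"
  "word_bullet p (q + q') = word_bullet p q + word_bullet p q'"
  "word_bullet (scale c p) q = scale c (word_bullet p q)"
  "word_bullet p (scale c q) = scale c (word_bullet p q)"
  "word_bullet (basis v) (basis w) = bullet_words v w"
  by (simp_all add: word_bullet_def bilinear_ext_simps)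

lemma word_sqcup_Nil_left: "word_sqcup (basis []) q = q"
  by (induction q rule: basis_induct) (simp_all add: word_sqcup_simps)

lemma word_bullet_Nil_left: "word_bullet (basis []) q = 0"
  by (induction q rule: basis_induct) (simp_all add: word_bullet_simps)

lemma prepend_0 [simp]: "prepend x 0 = 0"
  by (simp add: prepend_def linear_ext_def)

text \<open>In the recursion for \<open>X1 # c\<close> an empty \<open>c\<close> kills the first
  summand and leaves a shuffle with the empty word. This is why grafting on \<open>dot L2\<close>
  becomes prepending \<open>X0\<close>.\<close>

lemma word_bullet_X1: "word_bullet (basis [X1]) q = prepend X0 q"
  by (induction q rule: basis_induct) (simp_all add: word_bullet_simps prepend_simps)

lemma word_bullet_prepend_X0: "word_bullet (prepend X0 p) q = prepend X0 (word_bullet p q)"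
proof (induction p rule: basis_induct)
  case (basis v)
  show ?case
    by (induction q rule: basis_induct) (simp_all add: word_bullet_simps prepend_simps)
qed (simp_all add: word_bullet_simps prepend_simps)

text \<open>The shuffle recursion extended bilinearly. For \<open>x = y = X0\<close> it is the
  integration by parts formula of iterated integrals, the source of relation 4.\<close>

lemma word_sqcup_prepend:
  "word_sqcup (prepend x p) (prepend y q) =
     prepend x (word_sqcup p (prepend y q)) + prepend y (word_sqcup (prepend x p) q)"
proof (induction p rule: basis_induct)
  case (basis v)
  show ?case
    by (induction q rule: basis_induct)
      (simp_all add: word_sqcup_simps prepend_simps algebra_simps free_vs.scale_right_distrib)
qed (simp_all add: word_sqcup_simps prepend_simps algebra_simps free_vs.scale_right_distrib)

text \<open>Among the words of a given length, \<open>word_val\<close> realises the lexicographic order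
  with \<open>X0 < X1\<close>.\<close>

fun word_val :: "letter list \<Rightarrow> nat" where
  "word_val [] = 0"
| "word_val (X0 # w) = word_val w"
| "word_val (X1 # w) = 2 ^ length w + word_val w"

lemma word_val_less: "word_val w < 2 ^ length w"
  by (induction w rule: word_val.induct) auto

text \<open>Binary digits: by \<open>word_val_less\<close> a tail is too small to compensate for a
  different first letter. The lengths must agree because leading letters \<open>X0\<close> are
  invisible to \<open>word_val\<close>.\<close>

lemma word_val_inj: "length v = length w \<Longrightarrow> word_val v = word_val w \<Longrightarrow> v = w"
proof (induction v w rule: list_induct2')
  case (4 x xs y ys)
  then show ?case using word_val_less[of xs] word_val_less[of ys] by (cases x; cases y) auto
qed auto

section \<open>Leading words and linear independence\<close>

lemma lookup_prepend:
  "Poly_Mapping.lookup (prepend x p) w = (case w of [] \<Rightarrow> 0 | y # v \<Rightarrow> if x = y then Poly_Mapping.lookup p v else 0)"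
  by (induction p rule: basis_induct) (auto simp: prepend_simps lookup_basis lookup_add split: list.split)

text \<open>The words of this shuffle arise by inserting one \<open>X1\<close> into
  \<open>w\<close>, and insertion at the front gives the largest value.\<close>

lemma shuffle_X1_leading:
  assumes "Poly_Mapping.lookup (shuffle_words [X1] w :: _ \<Rightarrow>\<^sub>0 'k::field) u \<noteq> 0"
  shows "length u = Suc (length w) \<and> word_val u \<le> word_val (X1 # w)"
  using assms
proof (induction w arbitrary: u)
  case Nil
  then show ?case by (auto simp: lookup_basis split: if_splits)
next
  case (Cons b w)
  show ?case
  proof (cases "u = X1 # b # w")
    \<comment> \<open>The summand of the recursion that starts with the inserted \<open>X1\<close>
      is the single word \<open>X1 # b # w\<close>, so \<open>u\<close> comes from the other summand
      and starts with \<open>b\<close>.\<close>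
    case False
    with Cons.prems obtain v where v: "u = b # v"
      "Poly_Mapping.lookup (shuffle_words [X1] w :: _ \<Rightarrow>\<^sub>0 'k::field) v \<noteq> 0"
      by (auto simp: lookup_add lookup_basis lookup_prepend prepend_simps split: list.splits if_splits)
    then show ?thesis using Cons.IH[OF v(2)] by (cases b) auto
  qed simp
qed

text \<open>The coefficient is \<open>1\<close> plus the number of leading letters \<open>X1\<close> of \<open>w\<close>.\<close>

lemma shuffle_X1_leading_coeff:
  "\<exists>n. Poly_Mapping.lookup (shuffle_words [X1] w :: _ \<Rightarrow>\<^sub>0 'k::field) (X1 # w) = of_nat (Suc n)"
proof (induction w)
  case Nil
  show ?case by (rule exI[of _ 0]) (simp add: lookup_basis)
next
  case (Cons b w)
  then obtain n where n:
    "Poly_Mapping.lookup (shuffle_words [X1] w :: _ \<Rightarrow>\<^sub>0 'k::field) (X1 # w) = of_nat (Suc n)" by blast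
  show ?case
  proof (cases b)
    case X0
    then show ?thesis by (intro exI[of _ 0]) (simp add: lookup_add lookup_prepend prepend_simps lookup_basis)
  next
    case X1
    then show ?thesis using n by (intro exI[of _ "Suc n"]) (simp add: lookup_add lookup_prepend prepend_simps lookup_basis)
  qed
qed

text \<open>These are the images of the trees \<open>ptree_mono w\<close>. The letter
  \<open>X1\<close> acts by a shuffle because that is the image of the product with
  \<open>dot L2\<close>.\<close>

fun word_mono :: "letter list \<Rightarrow> (letter list \<Rightarrow>\<^sub>0 'k::field)" where
  "word_mono [] = basis []"
| "word_mono (X0 # w) = prepend X0 (word_mono w)"
| "word_mono (X1 # w) = word_sqcup (basis [X1]) (word_mono w)"

lemma word_sqcup_basis_left:
  "word_sqcup (basis v) q = linear_ext (shuffle_words v) q"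
  by (simp add: word_sqcup_def bilinear_ext_altdef)

lemma lookup_linear_ext:
  "Poly_Mapping.lookup (linear_ext f p) b =
     (\<Sum>a\<in>Poly_Mapping.keys p. Poly_Mapping.lookup p a * Poly_Mapping.lookup (f a) b)"
  by (simp add: linear_ext_def lookup_sum)

text \<open>Triangularity: prepending \<open>X0\<close> preserves the comparison, and shuffling
  \<open>X1\<close> into a word \<open>v\<close> gives nothing above \<open>X1 # v\<close>, whose
  value grows with that of \<open>v\<close> at fixed length.\<close>

lemma word_mono_leading:
  "Poly_Mapping.lookup (word_mono w :: _ \<Rightarrow>\<^sub>0 'k::field) u \<noteq> 0 \<Longrightarrow>
     length u = length w \<and> word_val u \<le> word_val w"
proof (induction w arbitrary: u rule: word_mono.induct)
  case 1
  then show ?case by (auto simp: lookup_basis split: if_splits)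
next
  case (2 w)
  then show ?case by (auto simp: lookup_prepend split: list.splits if_splits)
next
  case (3 w)
  from 3(2) obtain v where v: "v \<in> Poly_Mapping.keys (word_mono w :: _ \<Rightarrow>\<^sub>0 'k)"
    "Poly_Mapping.lookup (shuffle_words [X1] v :: _ \<Rightarrow>\<^sub>0 'k) u \<noteq> 0"
    by (auto simp: word_sqcup_basis_left lookup_linear_ext elim!: sum.not_neutral_contains_not_neutral)
  then show ?case using 3(1)[of v] shuffle_X1_leading[OF v(2)] by (auto simp: in_keys_iff)
qed

lemma word_mono_leading_coeff:
  "Poly_Mapping.lookup (word_mono w :: _ \<Rightarrow>\<^sub>0 'k::field_char_0) w \<noteq> 0"
proof (induction w rule: word_mono.induct)
  case 1
  then show ?case by (auto simp: lookup_basis)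
next
  case (2 w)
  then show ?case by (auto simp: lookup_prepend)
next
  case (3 w)
  let ?p = "word_mono w :: _ \<Rightarrow>\<^sub>0 'k"
  \<comment> \<open>Terms other than the leading one cannot reach \<open>X1 # w\<close>: such a
    \<open>v\<close> would have at least the value of \<open>w\<close>, and by maximality and
    injectivity it would equal \<open>w\<close>.\<close>
  have "Poly_Mapping.lookup (shuffle_words [X1] v :: _ \<Rightarrow>\<^sub>0 'k) (X1 # w) = 0"
    if v: "v \<in> Poly_Mapping.keys ?p - {w}" for v
  proof (rule ccontr)
    assume "\<not> ?thesis"
    then have "word_val w \<le> word_val v" "length v = length w" using shuffle_X1_leading by fastforce+
    moreover have "word_val v \<le> word_val w" using v word_mono_leading by (auto simp: in_keys_iff)
    ultimately show False using v word_val_inj by fastforce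
  qed
  then have "Poly_Mapping.lookup (word_mono (X1 # w) :: _ \<Rightarrow>\<^sub>0 'k) (X1 # w) =
    (\<Sum>v\<in>{w}. Poly_Mapping.lookup ?p v * Poly_Mapping.lookup (shuffle_words [X1] v :: _ \<Rightarrow>\<^sub>0 'k) (X1 # w))"
    unfolding word_mono.simps word_sqcup_basis_left lookup_linear_ext
    using 3 by (intro sum.mono_neutral_right) (auto simp: in_keys_iff)
  moreover obtain n where
    "Poly_Mapping.lookup (shuffle_words [X1] w :: _ \<Rightarrow>\<^sub>0 'k) (X1 # w) = of_nat (Suc n)"
    using shuffle_X1_leading_coeff by blast
  \<comment> \<open>Characteristic zero enters here: \<open>of_nat (Suc n)\<close>, kept unexpanded,
    is nonzero.\<close>
  ultimately show ?case using 3 by (simp del: of_nat_Suc)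
qed

text \<open>A word of maximal value among those of its length in the support occurs in no other
  \<open>word_mono u\<close> with \<open>u\<close> in the support, so its coefficient cannot
  cancel.\<close>

lemma word_mono_independent:
  fixes p :: "letter list \<Rightarrow>\<^sub>0 'k::field_char_0"
  assumes "linear_ext word_mono p = 0"
  shows "p = 0"
proof (rule ccontr)
  assume "p \<noteq> 0"
  then obtain v where v: "v \<in> Poly_Mapping.keys p" by (metis keys_eq_empty ex_in_conv)
  \<comment> \<open>\<open>word_val\<close> separates words only within one length, so one length is
    fixed. Other lengths do not interfere, since all words of \<open>word_mono u\<close> are as long
    as \<open>u\<close>.\<close>
  let ?K = "{u \<in> Poly_Mapping.keys p. length u = length v}"
  obtain w where w: "w \<in> ?K" and max: "\<And>u. u \<in> ?K \<Longrightarrow> word_val u \<le> word_val w"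
  proof -
    have K: "finite ?K" "?K \<noteq> {}" using v by auto
    then have "Max (word_val ` ?K) \<in> word_val ` ?K" by (intro Max_in) auto
    then obtain w where w: "w \<in> ?K" "Max (word_val ` ?K) = word_val w" by (rule imageE)
    have "word_val u \<le> word_val w" if "u \<in> ?K" for u
      unfolding w(2)[symmetric] by (rule Max_ge) (use K that in auto)
    then show thesis using that w(1) by blast
  qed
  have "Poly_Mapping.lookup (word_mono u :: _ \<Rightarrow>\<^sub>0 'k) w = 0" if u: "u \<in> Poly_Mapping.keys p - {w}" for u
  proof (rule ccontr)
    assume "\<not> ?thesis"
    then have "length w = length u" "word_val w \<le> word_val u" using word_mono_leading by blast+
    moreover from this have "word_val u \<le> word_val w" using u w max by auto
    ultimately show False using u word_val_inj by fastforce
  qed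
  then have "Poly_Mapping.lookup (linear_ext word_mono p) w =
     (\<Sum>u\<in>{w}. Poly_Mapping.lookup p u * Poly_Mapping.lookup (word_mono u :: _ \<Rightarrow>\<^sub>0 'k) w)"
    unfolding lookup_linear_ext using w by (intro sum.mono_neutral_right) auto
  then have "Poly_Mapping.lookup p w * Poly_Mapping.lookup (word_mono w :: _ \<Rightarrow>\<^sub>0 'k) w = 0"
    using assms by simp
  then show False using w word_mono_leading_coeff[of w, where 'k = 'k] by (auto simp: in_keys_iff)
qed

section \<open>Isomorphisms of merged and grafted trees\<close>

text \<open>Encoding the partition as a relation turns compatibility of a map with the parts into a
  condition on pairs of vertices, like the one on edges.\<close>

definition same_part :: "'d pforest \<Rightarrow> nat \<Rightarrow> nat \<Rightarrow> bool" where
  "same_part F v w \<longleftrightarrow> (\<exists>B\<in>parts F. v \<in> B \<and> w \<in> B)"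

text \<open>A partition is determined by its equivalence relation, so a surjection that preserves
  and reflects the relation carries blocks onto blocks.\<close>

lemma image_partition_eqI:
  assumes P: "partition_on V P" and Q: "partition_on W Q" and f: "f ` V = W"
    and rel: "\<And>v w. v \<in> V \<Longrightarrow> w \<in> V \<Longrightarrow> (\<exists>B\<in>P. v \<in> B \<and> w \<in> B) \<longleftrightarrow> (\<exists>B\<in>Q. f v \<in> B \<and> f w \<in> B)"
  shows "image f ` P = Q"
proof -
  have uP: "\<And>A B x. A \<in> P \<Longrightarrow> B \<in> P \<Longrightarrow> x \<in> A \<Longrightarrow> x \<in> B \<Longrightarrow> A = B"
    using P unfolding partition_on_def disjoint_def by blast
  have uQ: "\<And>A B x. A \<in> Q \<Longrightarrow> B \<in> Q \<Longrightarrow> x \<in> A \<Longrightarrow> x \<in> B \<Longrightarrow> A = B"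
    using Q unfolding partition_on_def disjoint_def by blast
  have PV: "\<Union> P = V" and QW: "\<Union> Q = W" and ne: "{} \<notin> P" "{} \<notin> Q"
    using P Q by (auto simp: partition_on_def)
  \<comment> \<open>A single vertex of \<open>B\<close> with image in \<open>C\<close> already
    forces the image of \<open>B\<close> to be all of \<open>C\<close>.\<close>
  have key: "f ` B = C" if BC: "B \<in> P" "C \<in> Q" and v: "v \<in> B" "f v \<in> C" for B C v
  proof (intro equalityI subsetI)
    have vV: "v \<in> V" using PV BC v by blast
    {
      fix y assume "y \<in> f ` B"
      then obtain w where w: "w \<in> B" "y = f w" by blast
      then have "w \<in> V" using PV BC by blast
      then obtain D where "D \<in> Q" "f v \<in> D" "f w \<in> D" using rel[OF vV] BC v w by blast
      then show "y \<in> C" using uQ BC v w by blast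
    next
      fix y assume y: "y \<in> C"
      then obtain w where w: "w \<in> V" "y = f w" using QW BC f by blast
      then obtain D where "D \<in> P" "v \<in> D" "w \<in> D" using rel[OF vV] BC v y by blast
      then show "y \<in> f ` B" using uP BC v w by blast
    }
  qed
  show ?thesis
  proof (intro equalityI subsetI)
    fix C assume "C \<in> image f ` P"
    then obtain B where B: "B \<in> P" "C = f ` B" by blast
    then obtain v where v: "v \<in> B" using ne by fastforce
    then have "f v \<in> W" using PV f B by blast
    then obtain D where "D \<in> Q" "f v \<in> D" using QW by blast
    then show "C \<in> Q" using key B v by blast
  next
    fix C assume C: "C \<in> Q"
    then obtain y where y: "y \<in> C" using ne by fastforce
    then obtain v where v: "v \<in> V" "y = f v" using QW f C by blast
    then obtain B where B: "B \<in> P" "v \<in> B" using PV by blast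
    then have "f ` B = C" using key C y v by blast
    then show "C \<in> image f ` P" using B by blast
  qed
qed

lemma ptree_isoI:
  assumes "partitioned_tree F" "partitioned_tree G"
    and "inj_on f (verts F)" "f ` verts F = verts G"
    and "\<forall>v\<in>verts F. \<forall>w\<in>verts F. (v, w) \<in> edges F \<longleftrightarrow> (f v, f w) \<in> edges G"
    and "\<forall>v\<in>verts F. \<forall>w\<in>verts F. same_part F v w \<longleftrightarrow> same_part G (f v) (f w)"
    and "\<forall>v\<in>verts F. dec G (f v) = dec F v"
  shows "ptree_iso F G"
proof -
  have "image f ` parts F = parts G"
    using assms(6) by (intro image_partition_eqI[OF partitioned_forestD(5) partitioned_forestD(5)]
        partitioned_treeD(1) assms) (auto simp: same_part_def)
  then have "pforest_iso_via f F G"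
    using assms by (simp add: pforest_iso_via_def bij_betw_def)
  then show ?thesis using assms by (auto simp: ptree_iso_def)
qed

lemma same_part_sym: "same_part F v w \<longleftrightarrow> same_part F w v"
  by (auto simp: same_part_def)

lemma same_part_refl: "partitioned_tree F \<Longrightarrow> v \<in> verts F \<Longrightarrow> same_part F v v"
  using partitioned_forestD(6)[OF partitioned_treeD(1)] by (auto simp: same_part_def)

lemma same_part_roots:
  "partitioned_tree F \<Longrightarrow> v \<in> roots F \<Longrightarrow> same_part F v w \<longleftrightarrow> w \<in> roots F"
  unfolding same_part_def using part_eq_roots[of F _ v] roots_in_parts[of F] by blast

lemma same_part_disjoint_union:
  "same_part (disjoint_union Fs) (emb i v) (emb j w) \<longleftrightarrow> i = j \<and> i < length Fs \<and> same_part (Fs ! i) v w"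
proof -
  have "same_part (disjoint_union Fs) (emb i v) (emb j w) \<longleftrightarrow>
    (\<exists>k\<in>{..<length Fs}. \<exists>C\<in>parts (Fs ! k). emb i v \<in> emb k ` C \<and> emb j w \<in> emb k ` C)"
    by (simp add: same_part_def disjoint_union_def)
  also have "\<dots> \<longleftrightarrow> (\<exists>k\<in>{..<length Fs}. i = k \<and> j = k \<and> (\<exists>C\<in>parts (Fs ! k). v \<in> C \<and> w \<in> C))"
    by (simp add: image_iff) blast
  finally show ?thesis by (auto simp: same_part_def)
qed

lemma verts_merge_eq: "verts (merge F G) = emb 0 ` verts F \<union> emb 1 ` verts G"
  by (auto simp: verts_merge verts_disjoint_union less_Suc_eq)

lemma edges_merge_iff:
  "(emb i v, emb j w) \<in> edges (merge F G) \<longleftrightarrow>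
     (i = 0 \<and> j = 0 \<and> (v, w) \<in> edges F) \<or> (i = 1 \<and> j = 1 \<and> (v, w) \<in> edges G)"
  by (auto simp: edges_merge edges_disjoint_union less_Suc_eq)

lemma dec_merge_emb: "dec (merge F G) (emb 0 v) = dec F v" "dec (merge F G) (emb (Suc 0) v) = dec G v"
  by (simp_all add: dec_merge dec_disjoint_union)

lemma roots_merge_iff:
  "emb i v \<in> roots (merge F G) \<longleftrightarrow> (i = 0 \<and> v \<in> roots F) \<or> (i = 1 \<and> v \<in> roots G)"
  by (auto simp: roots_merge)

lemma same_part_merge:
  assumes F: "partitioned_tree F" and G: "partitioned_tree G"
  shows "same_part (merge F G) x y \<longleftrightarrow>
    same_part (disjoint_union [F, G]) x y \<or> (x \<in> roots (merge F G) \<and> y \<in> roots (merge F G))"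
proof -
  let ?P = "parts (disjoint_union [F, G])"
  have "same_part (merge F G) x y \<longleftrightarrow> (\<exists>B \<in> ?P - {emb 0 ` roots F, emb 1 ` roots G}. x \<in> B \<and> y \<in> B)
    \<or> (x \<in> roots (merge F G) \<and> y \<in> roots (merge F G))"
    by (auto simp: same_part_def parts_merge roots_merge)
  \<comment> \<open>Putting back the two removed parts changes nothing: a pair inside one of them
    consists of roots and is covered by the second disjunct.\<close>
  also have "\<dots> \<longleftrightarrow> (\<exists>B \<in> ?P. x \<in> B \<and> y \<in> B) \<or> (x \<in> roots (merge F G) \<and> y \<in> roots (merge F G))"
    unfolding roots_merge by blast
  finally show ?thesis by (simp add: same_part_def)
qed

lemma same_part_merge_iff:
  assumes F: "partitioned_tree F" and G: "partitioned_tree G"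
  shows "same_part (merge F G) (emb i v) (emb j w) \<longleftrightarrow>
    (i = 0 \<and> j = 0 \<and> same_part F v w) \<or> (i = 1 \<and> j = 1 \<and> same_part G v w) \<or>
    (i = 0 \<and> j = 1 \<and> v \<in> roots F \<and> w \<in> roots G) \<or> (i = 1 \<and> j = 0 \<and> v \<in> roots G \<and> w \<in> roots F)"
  using same_part_roots[OF F] same_part_roots[OF G]
  by (auto simp: same_part_merge[OF assms] same_part_disjoint_union roots_merge_iff less_Suc_eq)

lemma merge_commute_iso:
  assumes F: "partitioned_tree F" and G: "partitioned_tree G"
  shows "ptree_iso (merge F G) (merge G F)"
proof -
  note T = partitioned_tree_merge[OF F G] partitioned_tree_merge[OF G F]
  show ?thesis
    \<comment> \<open>The map swaps the tags \<open>0\<close> and \<open>1\<close> of the two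
      summands.\<close>
    by (rule ptree_isoI[OF T, where f = "\<lambda>x. case prod_decode x of (i, v) \<Rightarrow> emb (1 - i) v"])
      (simp_all add: verts_merge_eq image_Un image_image ball_Un Un_commute
        edges_merge_iff same_part_merge_iff[OF F G] same_part_merge_iff[OF G F] dec_merge_emb inj_on_def conj_commute)
qed

lemma merge_assoc_iso:
  assumes F: "partitioned_tree F" and G: "partitioned_tree G" and H: "partitioned_tree H"
  shows "ptree_iso (merge (merge F G) H) (merge F (merge G H))"
proof -
  note FG = partitioned_tree_merge[OF F G] and GH = partitioned_tree_merge[OF G H]
  note T = partitioned_tree_merge[OF FG H] partitioned_tree_merge[OF F GH]
  show ?thesis
    \<comment> \<open>Retagging from left to right bracketing: \<open>F\<close> loses a tag,
      \<open>G\<close> exchanges its two tags and \<open>H\<close> gains one.\<close>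
    by (rule ptree_isoI[OF T, where f = "\<lambda>x. case prod_decode x of (i, y) \<Rightarrow>
          if i = 0 then (case prod_decode y of (j, v) \<Rightarrow> if j = 0 then emb 0 v else emb 1 (emb 0 v))
          else emb 1 (emb 1 y)"])
      (simp_all add: verts_merge_eq image_Un image_image ball_Un Un_assoc edges_merge_iff
        same_part_merge_iff[OF F G] same_part_merge_iff[OF G H] same_part_merge_iff[OF FG H]
        same_part_merge_iff[OF F GH] dec_merge_emb roots_merge_iff inj_on_def)
qed

section \<open>Iterated grafting\<close>

lemma verts_graft_eq:
  "verts (graft F s Gs) = emb 0 ` verts F \<union> (\<Union>i<length Gs. emb (Suc i) ` verts (Gs ! i))"
  by (simp add: verts_graft disjoint_union_def lessThan_Suc_eq_insert_0 image_image)

lemma verts_graft_iff: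
  "emb 0 v \<in> verts (graft F s Gs) \<longleftrightarrow> v \<in> verts F"
  "emb (Suc i) v \<in> verts (graft F s Gs) \<longleftrightarrow> i < length Gs \<and> v \<in> verts (Gs ! i)"
  by (simp_all add: verts_graft verts_disjoint_union)

lemma edges_graft_iff:
  "(emb 0 v, emb 0 w) \<in> edges (graft F s Gs) \<longleftrightarrow> (v, w) \<in> edges F"
  "(emb 0 v, emb (Suc j) w) \<notin> edges (graft F s Gs)"
  "(emb (Suc i) v, emb 0 w) \<in> edges (graft F s Gs) \<longleftrightarrow> i < length Gs \<and> w = s \<and> v \<in> roots (Gs ! i)"
  "(emb (Suc i) v, emb (Suc j) w) \<in> edges (graft F s Gs) \<longleftrightarrow> i = j \<and> i < length Gs \<and> (v, w) \<in> edges (Gs ! i)"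
  by (simp_all add: edges_graft edges_disjoint_union) auto

lemma same_part_graft:
  "same_part (graft F s Gs) = same_part (disjoint_union (F # Gs))"
  by (simp add: same_part_def parts_graft fun_eq_iff)

lemma same_part_graft_iff:
  "same_part (graft F s Gs) (emb 0 v) (emb 0 w) \<longleftrightarrow> same_part F v w"
  "\<not> same_part (graft F s Gs) (emb 0 v) (emb (Suc j) w)"
  "\<not> same_part (graft F s Gs) (emb (Suc i) v) (emb 0 w)"
  "same_part (graft F s Gs) (emb (Suc i) v) (emb (Suc j) w) \<longleftrightarrow> i = j \<and> i < length Gs \<and> same_part (Gs ! i) v w"
  by (auto simp: same_part_graft same_part_disjoint_union)

lemma dec_graft_emb:
  "dec (graft F s Gs) (emb 0 v) = dec F v" "dec (graft F s Gs) (emb (Suc i) v) = dec (Gs ! i) v"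
  by (simp_all add: dec_graft dec_disjoint_union)

lemma roots_graft_tree: "partitioned_tree F \<Longrightarrow> roots (graft F s Gs) = emb 0 ` roots F"
  by (simp add: roots_graft partitioned_treeD(1) partitioned_forestD(2))

text \<open>Grafting once more on \<open>r\<close> only appends to the list of grafted trees. This
  yields the longest brace in \<open>bullet_tree_brace\<close>.\<close>

lemma graft_same_vertex_iso:
  assumes F: "partitioned_tree F" "r \<in> verts F" and G: "partitioned_tree G"
    and Gs: "\<And>H. H \<in> set Gs \<Longrightarrow> partitioned_tree H"
  shows "ptree_iso (graft (graft F r Gs) (emb 0 r) [G]) (graft F r (Gs @ [G]))"
proof -
  have T: "partitioned_tree (graft F r Gs)" "partitioned_tree (graft F r (Gs @ [G]))"
    using assms by (auto intro!: partitioned_tree_graft)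
  have T': "partitioned_tree (graft (graft F r Gs) (emb 0 r) [G])"
    using F G T by (auto intro!: partitioned_tree_graft simp: verts_graft_iff)
  show ?thesis
    \<comment> \<open>Old vertices keep their inner tag. The new tree has position
      \<open>length Gs\<close> in the list, hence tag \<open>Suc (length Gs)\<close>, because tag
      \<open>0\<close> belongs to \<open>F\<close>.\<close>
    by (rule ptree_isoI[OF T' T(2), where f = "\<lambda>x. case prod_decode x of (i, y) \<Rightarrow>
          if i = 0 then y else emb (Suc (length Gs)) y"])
      (simp_all add: verts_graft_eq image_Un image_image image_UN lessThan_Suc ball_Un Un_ac
        edges_graft_iff same_part_graft_iff dec_graft_emb roots_graft_tree F G T nth_append inj_on_def less_Suc_eq)
qed

text \<open>Grafting on a vertex of one grafted tree changes that tree alone, which accounts for the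
  sum over the children in \<open>bullet_tree_brace\<close>.\<close>

lemma graft_child_vertex_iso:
  assumes F: "partitioned_tree F" "r \<in> verts F" and G: "partitioned_tree G"
    and Gs: "\<And>H. H \<in> set Gs \<Longrightarrow> partitioned_tree H"
    and i: "i < length Gs" and v: "v \<in> verts (Gs ! i)"
  shows "ptree_iso (graft (graft F r Gs) (emb (Suc i) v) [G]) (graft F r (Gs[i := graft (Gs ! i) v [G]]))"
proof -
  let ?K = "graft (Gs ! i) v [G]"
  have Gi: "partitioned_tree (Gs ! i)" using i Gs by simp
  have K: "partitioned_tree ?K"
    using i Gs v G by (auto intro!: partitioned_tree_graft)
  have T: "partitioned_tree (graft F r Gs)" "partitioned_tree (graft F r (Gs[i := ?K]))"
    using F Gs K set_update_subset_insert[of Gs i ?K] by (auto intro!: partitioned_tree_graft)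
  have T': "partitioned_tree (graft (graft F r Gs) (emb (Suc i) v) [G])"
    using F G T i v by (auto intro!: partitioned_tree_graft simp: verts_graft_iff)
  \<comment> \<open>Old vertices lose the outer tag \<open>0\<close>, but those of the
    \<open>i\<close>-th tree receive an inner tag \<open>0\<close> instead; the vertices of
    \<open>G\<close> move into position \<open>i\<close> with inner tag \<open>1\<close>.\<close>
  let ?f = "\<lambda>x. case prod_decode x of (l, y) \<Rightarrow>
      if l = 0 then (case prod_decode y of (j, u) \<Rightarrow> if j = Suc i then emb (Suc i) (emb 0 u) else y)
      else emb (Suc i) (emb 1 y)"
  show ?thesis
  proof (rule ptree_isoI[OF T' T(2), where f = ?f])
    let ?L = "graft (graft F r Gs) (emb (Suc i) v) [G]"
    \<comment> \<open>The \<open>i\<close>-th tree is listed apart because only its old vertices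
      gain an inner tag.\<close>
    have *: "verts ?L = emb 0 ` emb 0 ` verts F \<union> (\<Union>k\<in>{..<length Gs} - {i}. emb 0 ` emb (Suc k) ` verts (Gs ! k))
      \<union> emb 0 ` emb (Suc i) ` verts (Gs ! i) \<union> emb 1 ` verts G"
      using i by (auto simp: verts_graft_eq image_Un image_UN)
    have "?f ` verts ?L = emb 0 ` verts F \<union> (\<Union>k\<in>{..<length Gs} - {i}. emb (Suc k) ` verts (Gs ! k))
       \<union> emb (Suc i) ` verts ?K"
      unfolding * by (simp add: image_Un image_UN image_image verts_graft_eq Un_assoc lessThan_Suc)
    also have "\<dots> = emb 0 ` verts F \<union> (\<Union>k\<in>{..<length Gs}. emb (Suc k) ` verts (Gs[i := ?K] ! k))"
    proof -
      have e: "{..<length Gs} = insert i ({..<length Gs} - {i})" using i by auto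
      have "(\<Union>k\<in>{..<length Gs}. emb (Suc k) ` verts (Gs[i := ?K] ! k)) =
        emb (Suc i) ` verts ?K \<union> (\<Union>k\<in>{..<length Gs} - {i}. emb (Suc k) ` verts (Gs[i := ?K] ! k))"
        by (subst e) (simp only: UN_insert nth_list_update_eq[OF i])
      also have "(\<Union>k\<in>{..<length Gs} - {i}. emb (Suc k) ` verts (Gs[i := ?K] ! k)) =
        (\<Union>k\<in>{..<length Gs} - {i}. emb (Suc k) ` verts (Gs ! k))"
        by (rule SUP_cong) simp_all
      finally show ?thesis by (simp add: Un_ac)
    qed
    finally show "?f ` verts ?L = verts (graft F r (Gs[i := ?K]))"
      by (simp add: verts_graft_eq)
    show "inj_on ?f (verts ?L)"
      unfolding * by (simp add: inj_on_def ball_Un)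
  next
    show "\<forall>x\<in>verts (graft (graft F r Gs) (emb (Suc i) v) [G]). \<forall>y\<in>verts (graft (graft F r Gs) (emb (Suc i) v) [G]).
       ((x, y) \<in> edges (graft (graft F r Gs) (emb (Suc i) v) [G])) \<longleftrightarrow> (?f x, ?f y) \<in> edges (graft F r (Gs[i := ?K]))"
      using i by (simp add: verts_graft_eq ball_Un edges_graft_iff roots_graft_tree F G T K Gi image_iff)
  next
    show "\<forall>x\<in>verts (graft (graft F r Gs) (emb (Suc i) v) [G]). \<forall>y\<in>verts (graft (graft F r Gs) (emb (Suc i) v) [G]).
       same_part (graft (graft F r Gs) (emb (Suc i) v) [G]) x y \<longleftrightarrow> same_part (graft F r (Gs[i := ?K])) (?f x) (?f y)"
      using i by (simp add: verts_graft_eq ball_Un same_part_graft_iff)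
  next
    show "\<forall>x\<in>verts (graft (graft F r Gs) (emb (Suc i) v) [G]).
       dec (graft F r (Gs[i := ?K])) (?f x) = dec (graft (graft F r Gs) (emb (Suc i) v) [G]) x"
      using i by (simp add: verts_graft_eq ball_Un dec_graft_emb)
  qed
qed

section \<open>Decomposition of partitioned trees\<close>

text \<open>Edges leaving \<open>U\<close> are cut, which turns their sources into roots; empty
  traces of parts are dropped so that a partition remains.\<close>

definition restrict_forest :: "'d pforest \<Rightarrow> nat set \<Rightarrow> 'd pforest" where
  "restrict_forest F U = F\<lparr>verts := U \<inter> verts F, edges := edges F \<inter> U \<times> U,
     parts := (\<inter>) U ` parts F - {{}}\<rparr>"

lemma restrict_forest_simps [simp]:
  "verts (restrict_forest F U) = U \<inter> verts F"
  "edges (restrict_forest F U) = edges F \<inter> U \<times> U"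
  "dec (restrict_forest F U) = dec F"
  by (simp_all add: restrict_forest_def)

lemma same_part_restrict_forest [simp]:
  "same_part (restrict_forest F U) v w \<longleftrightarrow> v \<in> U \<and> w \<in> U \<and> same_part F v w"
  by (auto simp: same_part_def restrict_forest_def)

lemma same_part_siblings:
  assumes "partitioned_forest F" "same_part F v w"
  shows "(v \<in> roots F \<and> w \<in> roots F) \<or> (\<exists>u. (v, u) \<in> edges F \<and> (w, u) \<in> edges F)"
  using assms unfolding partitioned_forest_def same_part_def by blast

lemma same_part_trans:
  assumes "partitioned_forest F" "same_part F u v" "same_part F v w"
  shows "same_part F u w"
proof -
  obtain B C where "B \<in> parts F" "u \<in> B" "v \<in> B" "C \<in> parts F" "v \<in> C" "w \<in> C"
    using assms(2,3) by (auto simp: same_part_def)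
  moreover from this have "B = C"
    using partitioned_forestD(5)[OF assms(1)] unfolding partition_on_def disjoint_def by blast
  ultimately show ?thesis by (auto simp: same_part_def)
qed

text \<open>This holds for every \<open>U\<close>: two vertices of one part with a common direct
  descendant either both keep their edge to it or both become roots.\<close>

lemma partitioned_forest_restrict_forest:
  assumes F: "partitioned_forest F"
  shows "partitioned_forest (restrict_forest F U)"
proof -
  note D = partitioned_forestD[OF F]
  let ?R = "restrict_forest F U"
  have "acyclic (edges ?R)" using acyclic_subset[OF D(4)] by simp
  moreover have "single_valued (edges ?R)" using single_valued_subset[OF _ D(3)] by simp
  moreover have "edges ?R \<subseteq> verts ?R \<times> verts ?R" using D(2) by auto
  moreover have "partition_on (verts ?R) (parts ?R)"
    using partition_on_restrict[OF D(5), of U] by (simp add: restrict_forest_def)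
  moreover have "(v \<in> roots ?R \<and> w \<in> roots ?R) \<or> (\<exists>u. (v, u) \<in> edges ?R \<and> (w, u) \<in> edges ?R)"
    if "B \<in> parts ?R" "v \<in> B" "w \<in> B" for B v w
  proof -
    have s: "same_part ?R v w" using that by (auto simp: same_part_def)
    then have vw: "v \<in> U" "w \<in> U" "same_part F v w" by simp_all
    then have V: "v \<in> verts F" "w \<in> verts F" using D(6) by (auto simp: same_part_def)
    from same_part_siblings[OF F vw(3)] show ?thesis
    proof (elim disjE exE)
      assume "v \<in> roots F \<and> w \<in> roots F"
      then show ?thesis using vw by (auto simp: roots_def)
    next
      fix u assume u: "(v, u) \<in> edges F \<and> (w, u) \<in> edges F"
      show ?thesis
      proof (cases "u \<in> U")
        case True
        then show ?thesis using u vw by auto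
      next
        case False
        then have "v \<in> roots ?R" "w \<in> roots ?R"
          using u vw V D(3) by (auto simp: roots_def dest: single_valuedD)
        then show ?thesis by blast
      qed
    qed
  qed
  ultimately show ?thesis
    using D(1) unfolding partitioned_forest_def rooted_forest_def by auto
qed

lemma partitioned_treeI:
  assumes F: "partitioned_forest F" "verts F \<noteq> {}"
    and R: "\<And>v w. v \<in> roots F \<Longrightarrow> w \<in> roots F \<Longrightarrow> same_part F v w"
  shows "partitioned_tree F"
proof -
  obtain r where r: "r \<in> roots F" using roots_nonempty[OF F] by blast
  obtain B where B: "B \<in> parts F" "r \<in> B" using R[OF r r] by (auto simp: same_part_def)
  have "w \<in> B" if w: "w \<in> roots F" for w
  proof -
    obtain C where "C \<in> parts F" "r \<in> C" "w \<in> C" using R[OF r w] by (auto simp: same_part_def)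
    moreover from this have "B = C"
      using B partitioned_forestD(5)[OF F(1)] unfolding partition_on_def disjoint_def by blast
    ultimately show ?thesis by simp
  qed
  then show ?thesis using F B by (auto simp: partitioned_tree_def)
qed

lemma verts_singleton_iso:
  assumes F: "partitioned_tree F" and r: "verts F = {r}"
  shows "ptree_iso F (single_vertex (dec F r))"
proof (rule ptree_isoI[where f = "\<lambda>_. 0"])
  have "(r, r) \<notin> edges F" using partitioned_forestD(4)[OF partitioned_treeD(1)[OF F]] by (auto simp: acyclic_def)
  then show "\<forall>v\<in>verts F. \<forall>w\<in>verts F. ((v, w) \<in> edges F) = ((0, 0) \<in> edges (single_vertex (dec F r)))"
    using r by (simp add: single_vertex_def)
  show "\<forall>v\<in>verts F. \<forall>w\<in>verts F. same_part F v w = same_part (single_vertex (dec F r)) 0 0"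
    using r same_part_refl[OF F] by (simp add: single_vertex_def same_part_def)
qed (use F r partitioned_tree_single_vertex in \<open>auto simp: single_vertex_def\<close>)

text \<open>The component of one root is split off. Another root lies outside it, so both pieces are
  nonempty and smaller.\<close>

lemma merge_decomposition:
  assumes F: "partitioned_tree F" and r: "r \<in> roots F" "roots F \<noteq> {r}"
  obtains G H where "partitioned_tree G" "partitioned_tree H" "ptree_iso F (merge G H)"
    "card (verts G) < card (verts F)" "card (verts H) < card (verts F)"
proof -
  note P = partitioned_treeD(1)[OF F] and D = partitioned_forestD[OF partitioned_treeD(1)[OF F]]
  define U where "U = {v. (v, r) \<in> (edges F)\<^sup>*}"
  \<comment> \<open>No edge crosses the boundary of \<open>U\<close>: a vertex has at most one
    direct descendant, so the path to the root is unique.\<close>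
  have closed: "v \<in> U \<longleftrightarrow> w \<in> U" if vw: "(v, w) \<in> edges F" for v w
  proof
    assume "v \<in> U"
    then have "(v, r) \<in> (edges F)\<^sup>*" by (simp add: U_def)
    then show "w \<in> U"
    proof (cases rule: converse_rtranclE)
      case base
      then show ?thesis using vw r by (auto simp: roots_def)
    next
      case (step y)
      then have "y = w" using vw D(3) by (auto dest: single_valuedD)
      then show ?thesis using step by (simp add: U_def)
    qed
  qed (use vw in \<open>auto simp: U_def\<close>)
  obtain r' where r': "r' \<in> roots F" "r' \<noteq> r" using r by blast
  have "r' \<notin> U"
  proof
    assume "r' \<in> U"
    then have "(r', r) \<in> (edges F)\<^sup>*" by (simp add: U_def)
    then show False using r' by (cases rule: converse_rtranclE) (auto simp: roots_def)
  qed
  moreover have "r \<in> U" by (simp add: U_def)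
  moreover have rV: "r \<in> verts F" "r' \<in> verts F" using r(1) r'(1) by (auto simp: roots_def)
  ultimately have psub: "U \<inter> verts F \<subset> verts F" "(- U) \<inter> verts F \<subset> verts F" and
    ne: "U \<inter> verts F \<noteq> {}" "(- U) \<inter> verts F \<noteq> {}" by auto
  let ?G = "restrict_forest F U" and ?H = "restrict_forest F (- U)"
  have roots: "roots ?G = U \<inter> roots F" "roots ?H = (- U) \<inter> roots F"
    using closed by (auto simp: roots_def)
  have G: "partitioned_tree ?G"
    by (rule partitioned_treeI[OF partitioned_forest_restrict_forest[OF P]])
      (use ne same_part_roots[OF F] in \<open>auto simp: roots\<close>)
  have H: "partitioned_tree ?H"
    by (rule partitioned_treeI[OF partitioned_forest_restrict_forest[OF P]])
      (use ne same_part_roots[OF F] in \<open>auto simp: roots\<close>)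
  \<comment> \<open>Vertices with a common direct descendant lie on the same side of
    \<open>U\<close>, so only the part of the roots can meet both sides.\<close>
  have cross: "same_part F v w \<longleftrightarrow> v \<in> roots F \<and> w \<in> roots F" if "(v \<in> U) \<noteq> (w \<in> U)" for v w
    using that same_part_siblings[OF P, of v w] same_part_roots[OF F] closed by blast
  let ?f = "\<lambda>v. if v \<in> U then emb 0 v else emb 1 v"
  have "ptree_iso F (merge ?G ?H)"
  proof (rule ptree_isoI[OF F partitioned_tree_merge[OF G H], where f = ?f])
    show "inj_on ?f (verts F)" by (auto simp: inj_on_def)
    show "?f ` verts F = verts (merge ?G ?H)" unfolding verts_merge_eq by auto
    show "\<forall>v\<in>verts F. \<forall>w\<in>verts F. ((v, w) \<in> edges F) = ((?f v, ?f w) \<in> edges (merge ?G ?H))"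
      using closed by (simp add: edges_merge_iff) blast
    show "\<forall>v\<in>verts F. \<forall>w\<in>verts F. same_part F v w = same_part (merge ?G ?H) (?f v) (?f w)"
      using cross by (simp add: same_part_merge_iff[OF G H] roots)
    show "\<forall>v\<in>verts F. dec (merge ?G ?H) (?f v) = dec F v"
      by (simp add: dec_merge_emb)
  qed
  then show thesis
    using that[OF G H] psubset_card_mono[OF D(1)] psub by simp
qed

text \<open>One part of the children of \<open>r\<close>, with everything above it, becomes the tree
  \<open>H\<close>. Since a whole part is taken, the partition of \<open>F\<close> is the disjoint
  union of those of \<open>G\<close> and \<open>H\<close>.\<close>

lemma graft_decomposition:
  assumes F: "partitioned_tree F" and r: "roots F = {r}" "verts F \<noteq> {r}"
  obtains G H where "partitioned_tree G" "partitioned_tree H" "ptree_iso F (graft G r [H])"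
    "roots G = {r}" "card (verts G) < card (verts F)" "card (verts H) < card (verts F)"
proof -
  note P = partitioned_treeD(1)[OF F] and D = partitioned_forestD[OF partitioned_treeD(1)[OF F]]
  have rV: "r \<in> verts F" and rE: "\<And>w. (r, w) \<notin> edges F" using r(1) by (auto simp: roots_def)
  have sv: "\<And>u v w. (u, v) \<in> edges F \<Longrightarrow> (u, w) \<in> edges F \<Longrightarrow> v = w"
    using D(3) by (auto dest: single_valuedD)
  \<comment> \<open>A child of \<open>r\<close> is found as a root of the forest without
    \<open>r\<close>: it is not a root of \<open>F\<close>, so its edge there must end in
    \<open>r\<close>.\<close>
  obtain c where c: "(c, r) \<in> edges F"
  proof -
    have "- {r} \<inter> verts F \<noteq> {}" using r(2) rV by auto
    then have "roots (restrict_forest F (- {r})) \<noteq> {}"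
      by (intro roots_nonempty partitioned_forest_restrict_forest P) simp
    then obtain c where "c \<in> roots (restrict_forest F (- {r}))" by blast
    moreover from this have "c \<notin> roots F" using r by (auto simp: roots_def)
    ultimately have "(c, r) \<in> edges F" by (auto simp: roots_def)
    then show thesis using that by blast
  qed
  have cV: "c \<in> verts F" using c D(2) by auto
  define C where "C = {v. same_part F c v}"
  have Cr: "(v, r) \<in> edges F" if "v \<in> C" for v
  proof -
    have "c \<notin> roots F" using c by (auto simp: roots_def)
    then show ?thesis using same_part_siblings[OF P, of c v] that c sv by (auto simp: C_def)
  qed
  have CV: "C \<subseteq> verts F" using Cr D(2) by auto
  define U where "U = {v. \<exists>d\<in>C. (v, d) \<in> (edges F)\<^sup>*}"
  have CU: "C \<subseteq> U" by (auto simp: U_def)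
  have cC: "c \<in> C" using same_part_refl[OF F cV] by (simp add: C_def)
  have rU: "r \<notin> U"
  proof
    assume "r \<in> U"
    then obtain d where d: "d \<in> C" "(r, d) \<in> (edges F)\<^sup>*" by (auto simp: U_def)
    from d(2) show False
      by (cases rule: converse_rtranclE) (use Cr[OF d(1)] rE in auto)
  qed
  have up: "v \<in> U" if "(v, w) \<in> edges F" "w \<in> U" for v w
    using that by (auto simp: U_def intro: converse_rtrancl_into_rtrancl)
  \<comment> \<open>Edges leave \<open>U\<close> only from vertices of \<open>C\<close>; these are
    exactly the edges that the grafting restores.\<close>
  have down: "w \<in> U" if vw: "(v, w) \<in> edges F" and v: "v \<in> U" "v \<notin> C" for v w
  proof -
    obtain d where d: "d \<in> C" "(v, d) \<in> (edges F)\<^sup>*" using v by (auto simp: U_def)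
    from d(2) show ?thesis
    proof (cases rule: converse_rtranclE)
      case base
      then show ?thesis using d v by simp
    next
      case (step y)
      then show ?thesis using sv[OF vw] d(1) by (auto simp: U_def)
    qed
  qed
  let ?G = "restrict_forest F (- U)" and ?H = "restrict_forest F U"
  have rootsH: "roots ?H = C"
  proof (intro equalityI subsetI)
    fix v assume v: "v \<in> roots ?H"
    show "v \<in> C"
    proof (rule ccontr)
      assume vC: "v \<notin> C"
      have "v \<in> U" "v \<in> verts F" using v by (auto simp: roots_def)
      then have "v \<notin> roots F" using r rU by auto
      then obtain w where "(v, w) \<in> edges F" using \<open>v \<in> verts F\<close> by (auto simp: roots_def)
      then show False using down[OF _ \<open>v \<in> U\<close> vC] v by (auto simp: roots_def)
    qed
  next
    fix v assume v: "v \<in> C"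
    then show "v \<in> roots ?H"
      using CU CV rU sv[OF Cr[OF v]] by (auto simp: roots_def)
  qed
  have rootsG: "roots ?G = {r}"
  proof (intro equalityI subsetI)
    fix v assume v: "v \<in> roots ?G"
    then have "v \<in> roots F" using up by (auto simp: roots_def)
    then show "v \<in> {r}" using r by simp
  qed (use rU rV rE in \<open>auto simp: roots_def\<close>)
  have H: "partitioned_tree ?H"
  proof (rule partitioned_treeI[OF partitioned_forest_restrict_forest[OF P]])
    show "verts ?H \<noteq> {}" using cC CU CV by auto
    fix v w assume "v \<in> roots ?H" "w \<in> roots ?H"
    then have "v \<in> C" "w \<in> C" by (simp_all add: rootsH)
    then show "same_part ?H v w"
      using same_part_trans[OF P, of v c w] same_part_sym[of F v c] CU by (auto simp: C_def)
  qed
  have G: "partitioned_tree ?G"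
  proof (rule partitioned_treeI[OF partitioned_forest_restrict_forest[OF P]])
    show "verts ?G \<noteq> {}" using rU rV by auto
    fix v w assume "v \<in> roots ?G" "w \<in> roots ?G"
    then show "same_part ?G v w" using rU same_part_refl[OF F rV] by (simp add: rootsG)
  qed
  \<comment> \<open>Parts do not straddle the cut: \<open>C\<close> is itself a part, and outside
    \<open>C\<close> the common direct descendant of two siblings lies in \<open>U\<close>, which
    pulls both into \<open>U\<close>.\<close>
  have cross: "\<not> same_part F v w" if v: "v \<in> U" and w: "w \<notin> U" for v w
  proof
    assume s: "same_part F v w"
    show False
    proof (cases "v \<in> C")
      case True
      then have "w \<in> C" using same_part_trans[OF P _ s] by (simp add: C_def)
      then show False using w CU by auto
    next
      case False
      have "v \<notin> roots F" using r v rU by auto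
      then obtain u where u: "(v, u) \<in> edges F" "(w, u) \<in> edges F"
        using same_part_siblings[OF P s] by auto
      then show False using down[OF u(1) v False] up w by blast
    qed
  qed
  have edge: "(v, w) \<in> edges F \<longleftrightarrow> w = r \<and> v \<in> C" if v: "v \<in> U" and w: "w \<notin> U" for v w
  proof
    assume vw: "(v, w) \<in> edges F"
    then have "v \<in> C" using down v w by blast
    then show "w = r \<and> v \<in> C" using sv[OF vw Cr] by blast
  qed (use Cr in blast)
  let ?f = "\<lambda>v. if v \<in> U then emb 1 v else emb 0 v"
  have T: "partitioned_tree (graft ?G r [?H])"
    using G H rV rU by (intro partitioned_tree_graft) auto
  have "ptree_iso F (graft ?G r [?H])"
  proof (rule ptree_isoI[OF F T, where f = ?f])
    show "inj_on ?f (verts F)" by (auto simp: inj_on_def)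
    show "?f ` verts F = verts (graft ?G r [?H])"
      unfolding verts_graft_eq by (auto simp: lessThan_Suc)
    show "\<forall>v\<in>verts F. \<forall>w\<in>verts F. ((v, w) \<in> edges F) = ((?f v, ?f w) \<in> edges (graft ?G r [?H]))"
    proof (intro ballI)
      fix v w
      show "((v, w) \<in> edges F) = ((?f v, ?f w) \<in> edges (graft ?G r [?H]))"
        using edge[of v w] up[of v w] by (cases "v \<in> U"; cases "w \<in> U") (auto simp: edges_graft_iff rootsH)
    qed
    show "\<forall>v\<in>verts F. \<forall>w\<in>verts F. same_part F v w = same_part (graft ?G r [?H]) (?f v) (?f w)"
    proof (intro ballI)
      fix v w
      show "same_part F v w = same_part (graft ?G r [?H]) (?f v) (?f w)"
        using cross[of v w] cross[of w v] same_part_sym[of F v w]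
        by (cases "v \<in> U"; cases "w \<in> U") (simp_all add: same_part_graft_iff)
    qed
    show "\<forall>v\<in>verts F. dec (graft ?G r [?H]) (?f v) = dec F v"
      by (simp add: dec_graft_emb)
  qed
  moreover have "- U \<inter> verts F \<subset> verts F" "U \<inter> verts F \<subset> verts F" using cC CU CV rU rV by auto
  ultimately show thesis
    using that[OF G H _ rootsG] psubset_card_mono[OF D(1)] by simp
qed

section \<open>Isomorphism classes\<close>

lemma abs_ptree_eqI: "ptree_iso F G \<Longrightarrow> abs_ptree F = abs_ptree G"
  using Quotient_rel_abs[OF Quotient_ptree] by blast

lemma abs_ptree_cases [case_names abs, cases type: ptree]:
  obtains F where "partitioned_tree F" "t = abs_ptree F"
  using Quotient_abs_rep[OF Quotient_ptree] Quotient_rep_reflp[OF Quotient_ptree]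
  by (metis ptree_iso_def)

lemma abs_ptree_list_cases:
  obtains Gs where "\<And>G. G \<in> set Gs \<Longrightarrow> partitioned_tree G" "ts = map abs_ptree Gs"
proof (induction ts arbitrary: thesis)
  case (Cons t ts)
  obtain F where "partitioned_tree F" "t = abs_ptree F" by (cases t)
  moreover obtain Gs where "\<And>G. G \<in> set Gs \<Longrightarrow> partitioned_tree G" "ts = map abs_ptree Gs"
    using Cons.IH by blast
  ultimately show ?case using Cons.prems[of "F # Gs"] by auto
qed simp

lemma sqcup_tree_abs:
  "partitioned_tree F \<Longrightarrow> partitioned_tree G \<Longrightarrow> sqcup_tree (abs_ptree F) (abs_ptree G) = abs_ptree (merge F G)"
  by (simp add: sqcup_tree.abs_eq ptree_iso_refl)

lemma brace_abs:
  "(\<And>G. G \<in> set Gs \<Longrightarrow> partitioned_tree G) \<Longrightarrow>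
     brace d (map abs_ptree Gs) = abs_ptree (graft (single_vertex d) 0 Gs)"
  by (intro brace.abs_eq) (auto simp: list_all2_same ptree_iso_refl)

lemma bullet_tree_abs:
  "partitioned_tree F \<Longrightarrow> partitioned_tree G \<Longrightarrow>
     bullet_tree (abs_ptree F) (abs_ptree G) = (\<Sum>s\<in>verts F. basis (abs_ptree (graft F s [G])))"
  by (simp add: bullet_tree.abs_eq ptree_iso_refl)

section \<open>Products and structural induction on classes\<close>

lemma sqcup_tree_commute: "sqcup_tree t u = sqcup_tree u t"
proof (cases t; cases u)
  fix F G :: "'a pforest"
  assume "partitioned_tree F" "t = abs_ptree F" "partitioned_tree G" "u = abs_ptree G"
  then show ?thesis by (simp add: sqcup_tree_abs abs_ptree_eqI merge_commute_iso)
qed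

lemma sqcup_tree_assoc: "sqcup_tree (sqcup_tree t u) v = sqcup_tree t (sqcup_tree u v)"
proof (cases t; cases u; cases v)
  fix F G H :: "'a pforest"
  assume "partitioned_tree F" "t = abs_ptree F" "partitioned_tree G" "u = abs_ptree G"
    "partitioned_tree H" "v = abs_ptree H"
  then show ?thesis
    by (simp add: sqcup_tree_abs partitioned_tree_merge abs_ptree_eqI merge_assoc_iso)
qed

lemma verts_single_vertex: "verts (single_vertex d) = {0}"
  by (simp add: single_vertex_def)

lemma brace_Nil: "brace d [] = dot d"
proof -
  let ?F = "graft (single_vertex d) 0 []"
  have "partitioned_tree ?F"
    by (intro partitioned_tree_graft partitioned_tree_single_vertex) (simp_all add: verts_single_vertex)
  moreover have "verts ?F = {emb 0 0}" by (simp add: verts_graft_eq verts_single_vertex)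
  ultimately have "ptree_iso ?F (single_vertex (dec ?F (emb 0 0)))" by (rule verts_singleton_iso)
  also have "dec ?F (emb 0 0) = d" by (simp only: dec_graft_emb) (simp add: single_vertex_def)
  finally show ?thesis using brace_abs[of "[]" d] by (simp add: dot.abs_eq abs_ptree_eqI)
qed

text \<open>The vertices available for grafting are sorted by the child to which they belong, and
  the root contributes the new child. Solved for the longest brace, this describes the trees of
  relations 1 and 2 inductively.\<close>

lemma bullet_tree_brace:
  "bullet_tree (brace d ts) t = basis (brace d (ts @ [t])) +
     (\<Sum>i<length ts. linear_ext (\<lambda>u. basis (brace d (ts[i := u]))) (bullet_tree (ts ! i) t))"
proof -
  obtain Gs where Gs: "\<And>G. G \<in> set Gs \<Longrightarrow> partitioned_tree G" "ts = map abs_ptree Gs"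
    using abs_ptree_list_cases[of ts] by blast
  obtain G where G: "partitioned_tree G" "t = abs_ptree G" by (cases t)
  let ?s = "single_vertex d"
  let ?F = "graft ?s 0 Gs"
  have s: "partitioned_tree ?s" "0 \<in> verts ?s"
    by (rule partitioned_tree_single_vertex) (simp add: verts_single_vertex)
  have F: "partitioned_tree ?F" using Gs s by (intro partitioned_tree_graft) auto
  have root: "abs_ptree (graft ?F (emb 0 0) [G]) = brace d (ts @ [t])"
  proof -
    have "brace d (map abs_ptree (Gs @ [G])) = abs_ptree (graft ?s 0 (Gs @ [G]))"
      by (rule brace_abs) (use Gs G in auto)
    then show ?thesis
      using abs_ptree_eqI[OF graft_same_vertex_iso[OF s G(1) Gs(1)]] Gs G by simp
  qed
  have child: "abs_ptree (graft ?F (emb (Suc i) v) [G]) = brace d (ts[i := abs_ptree (graft (Gs ! i) v [G])])"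
    if i: "i < length Gs" and v: "v \<in> verts (Gs ! i)" for i v
  proof -
    have K: "partitioned_tree (graft (Gs ! i) v [G])"
      using Gs(1) i v G(1) by (intro partitioned_tree_graft) auto
    have "brace d (map abs_ptree (Gs[i := graft (Gs ! i) v [G]])) =
        abs_ptree (graft ?s 0 (Gs[i := graft (Gs ! i) v [G]]))"
      by (rule brace_abs) (use Gs(1) K set_update_subset_insert in fastforce)
    then show ?thesis
      using abs_ptree_eqI[OF graft_child_vertex_iso[OF s G(1) Gs(1) i v]] Gs(2) by (simp add: map_update)
  qed
  have fin: "finite (verts H)" if "partitioned_tree H" for H :: "'a pforest"
    using that partitioned_treeD(1) partitioned_forestD(1) by blast
  have "bullet_tree (brace d ts) t = (\<Sum>s\<in>verts ?F. basis (abs_ptree (graft ?F s [G])))"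
    using bullet_tree_abs[OF F G(1)] brace_abs[of Gs d] Gs G by simp
  also have "\<dots> = (\<Sum>s\<in>emb 0 ` verts ?s. basis (abs_ptree (graft ?F s [G]))) +
      (\<Sum>s\<in>(\<Union>i<length Gs. emb (Suc i) ` verts (Gs ! i)). basis (abs_ptree (graft ?F s [G])))"
    unfolding verts_graft_eq[of ?s] using Gs(1) fin
    by (intro sum.union_disjoint) (auto simp: verts_single_vertex)
  also have "(\<Sum>s\<in>emb 0 ` verts ?s. basis (abs_ptree (graft ?F s [G])) :: _ \<Rightarrow>\<^sub>0 'b) = basis (brace d (ts @ [t]))"
    by (simp add: verts_single_vertex root)
  also have "(\<Sum>s\<in>(\<Union>i<length Gs. emb (Suc i) ` verts (Gs ! i)). basis (abs_ptree (graft ?F s [G])) :: _ \<Rightarrow>\<^sub>0 'b)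
      = (\<Sum>i<length Gs. \<Sum>s\<in>emb (Suc i) ` verts (Gs ! i). basis (abs_ptree (graft ?F s [G])))"
    using Gs(1) fin by (intro sum.UNION_disjoint) auto
  also have "\<dots> = (\<Sum>i<length ts. linear_ext (\<lambda>u. basis (brace d (ts[i := u]))) (bullet_tree (ts ! i) t))"
  proof (rule sum.cong)
    fix i assume "i \<in> {..<length ts}"
    then have i: "i < length Gs" using Gs(2) by simp
    have "(\<Sum>s\<in>emb (Suc i) ` verts (Gs ! i). basis (abs_ptree (graft ?F s [G])) :: _ \<Rightarrow>\<^sub>0 'b) =
      (\<Sum>v\<in>verts (Gs ! i). basis (abs_ptree (graft ?F (emb (Suc i) v) [G])))"
      by (subst sum.reindex) (auto simp: inj_on_def)
    also have "\<dots> = (\<Sum>v\<in>verts (Gs ! i). basis (brace d (ts[i := abs_ptree (graft (Gs ! i) v [G])])))"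
      using child[OF i] by (intro sum.cong) auto
    also have "\<dots> = linear_ext (\<lambda>u. basis (brace d (ts[i := u]))) (\<Sum>v\<in>verts (Gs ! i). basis (abs_ptree (graft (Gs ! i) v [G])))"
    proof -
      interpret L: Vector_Spaces.linear scale scale
        "linear_ext (\<lambda>u. basis (brace d (ts[i := u]))) :: ('a ptree \<Rightarrow>\<^sub>0 'b) \<Rightarrow> _"
        by (rule linear_linear_ext)
      show ?thesis by (simp add: L.sum)
    qed
    also have "(\<Sum>v\<in>verts (Gs ! i). basis (abs_ptree (graft (Gs ! i) v [G])) :: _ \<Rightarrow>\<^sub>0 'b) = bullet_tree (ts ! i) t"
      using i by (simp add: Gs(2) G(2) bullet_tree_abs[OF Gs(1)[OF nth_mem[OF i]] G(1)])
    finally show "(\<Sum>s\<in>emb (Suc i) ` verts (Gs ! i). basis (abs_ptree (graft ?F s [G])) :: _ \<Rightarrow>\<^sub>0 'b) =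
      linear_ext (\<lambda>u. basis (brace d (ts[i := u]))) (bullet_tree (ts ! i) t)" .
  qed (simp add: Gs(2))
  finally show ?thesis .
qed

text \<open>Equal classes give an isomorphism from \<open>F\<close> to the standard representative
  of the brace. It sends the only root \<open>r\<close> to the root there, so the two grafts are
  isomorphic.\<close>

lemma graft_root_brace:
  assumes F: "partitioned_tree F" "roots F = {r}" "abs_ptree F = brace d ts" and G: "partitioned_tree G"
  shows "abs_ptree (graft F r [G]) = brace d (ts @ [abs_ptree G])"
proof -
  obtain Gs where Gs: "\<And>G. G \<in> set Gs \<Longrightarrow> partitioned_tree G" "ts = map abs_ptree Gs"
    using abs_ptree_list_cases[of ts] by blast
  let ?s = "single_vertex d"
  let ?F = "graft ?s 0 Gs"
  have s: "partitioned_tree ?s" "0 \<in> verts ?s"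
    by (rule partitioned_tree_single_vertex) (simp add: verts_single_vertex)
  have F': "partitioned_tree ?F" using Gs s by (intro partitioned_tree_graft) auto
  have "abs_ptree F = abs_ptree ?F" using F(3) Gs brace_abs[of Gs d] by simp
  then have "ptree_iso F ?F"
    using Quotient_rel[OF Quotient_ptree] ptree_iso_refl F(1) F' by metis
  then obtain f where f: "pforest_iso_via f F ?F" by (auto simp: ptree_iso_def)
  have "f ` roots F = roots ?F"
    using iso_roots[OF _ _ f] F(1) F' partitioned_treeD(1) partitioned_forestD(2) by blast
  then have fr: "f r = emb 0 0"
    using F(2) roots_graft_tree[OF s(1), of 0 Gs] by (simp add: roots_def single_vertex_def)
  have "r \<in> verts F" using F(2) by (auto simp: roots_def)
  then have "ptree_iso (graft F r [G]) (graft ?F (emb 0 0) [G])"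
    using graft_iso[OF F(1) F' f, of r "[G]" "[G]"] G fr by (simp add: ptree_iso_refl)
  then have "abs_ptree (graft F r [G]) = abs_ptree (graft ?s 0 (Gs @ [G]))"
    using abs_ptree_eqI graft_same_vertex_iso[OF s G Gs(1)] by metis
  also have "\<dots> = brace d (map abs_ptree (Gs @ [G]))"
    by (rule brace_abs[symmetric]) (use Gs G in auto)
  finally show ?thesis using Gs(2) by simp
qed

text \<open>Induction on the number of vertices of a representative:
  \<open>merge_decomposition\<close> treats several roots, \<open>graft_decomposition\<close> a
  single one.\<close>

lemma ptree_induct [case_names brace sqcup]:
  assumes brace: "\<And>d ts. (\<And>t. t \<in> set ts \<Longrightarrow> P t) \<Longrightarrow> P (brace d ts)"
    and sqcup: "\<And>t u. P t \<Longrightarrow> P u \<Longrightarrow> P (sqcup_tree t u)"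
  shows "P t"
proof -
  \<comment> \<open>For a single root the claim also records the children: after
    \<open>graft_decomposition\<close> the children of \<open>G\<close> must satisfy
    \<open>P\<close> one by one, and \<open>P\<close> for \<open>G\<close> alone would not give
    this.\<close>
  have "P (abs_ptree F) \<and> (\<forall>r. roots F = {r} \<longrightarrow> (\<exists>d ts. abs_ptree F = brace d ts \<and> (\<forall>t\<in>set ts. P t)))"
    if "partitioned_tree F" for F
    using that
  proof (induction "card (verts F)" arbitrary: F rule: less_induct)
    case less
    obtain r where r: "r \<in> roots F"
      using roots_nonempty less.prems partitioned_treeD by blast
    show ?case
    proof (cases "roots F = {r}")
      case False
      obtain G H where GH: "partitioned_tree G" "partitioned_tree H" "ptree_iso F (merge G H)"
        "card (verts G) < card (verts F)" "card (verts H) < card (verts F)"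
        by (rule merge_decomposition[OF less.prems r False])
      then have "abs_ptree F = sqcup_tree (abs_ptree G) (abs_ptree H)"
        by (simp add: abs_ptree_eqI sqcup_tree_abs)
      then have "P (abs_ptree F)" using less.hyps GH sqcup by simp
      then show ?thesis using False r by auto
    next
      case rF: True
      have "\<exists>d ts. abs_ptree F = brace d ts \<and> (\<forall>t\<in>set ts. P t)"
      proof (cases "verts F = {r}")
        case True
        then have "abs_ptree F = brace (dec F r) []"
          by (simp add: brace_Nil dot.abs_eq abs_ptree_eqI verts_singleton_iso less.prems)
        then show ?thesis by (metis empty_iff empty_set)
      next
        case False
        obtain G H where GH: "partitioned_tree G" "partitioned_tree H" "ptree_iso F (graft G r [H])"
          "roots G = {r}" "card (verts G) < card (verts F)" "card (verts H) < card (verts F)"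
          by (rule graft_decomposition[OF less.prems rF False])
        then obtain d ts where ts: "abs_ptree G = brace d ts" "\<forall>t\<in>set ts. P t"
          using less.hyps by blast
        have "abs_ptree F = brace d (ts @ [abs_ptree H])"
          using graft_root_brace[OF GH(1,4) ts(1) GH(2)] abs_ptree_eqI[OF GH(3)] by simp
        moreover have "\<forall>t\<in>set (ts @ [abs_ptree H]). P t"
          using ts(2) less.hyps[OF GH(6,2)] by auto
        ultimately show ?thesis by blast
      qed
      then show ?thesis using brace rF by (metis singleton_inject)
    qed
  qed
  then show ?thesis by (cases t) auto
qed

section \<open>The morphism to words\<close>

lemma pt_sqcup_simps:
  "pt_sqcup (p + p') q = pt_sqcup p q + pt_sqcup p' q"
  "pt_sqcup p (q + q') = pt_sqcup p q + pt_sqcup p q'"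
  "pt_sqcup (scale c p) q = scale c (pt_sqcup p q)"
  "pt_sqcup p (scale c q) = scale c (pt_sqcup p q)"
  "pt_sqcup (basis t) (basis u) = basis (sqcup_tree t u)"
  by (simp_all add: pt_sqcup_def bilinear_ext_simps)

lemma pt_bullet_simps:
  "pt_bullet (p + p') q = pt_bullet p q + pt_bullet p' q"
  "pt_bullet p (q + q') = pt_bullet p q + pt_bullet p q'"
  "pt_bullet (scale c p) q = scale c (pt_bullet p q)"
  "pt_bullet p (scale c q) = scale c (pt_bullet p q)"
  "pt_bullet (basis t) (basis u) = bullet_tree t u"
  by (simp_all add: pt_bullet_def bilinear_ext_simps)

lemma pt_bullet_dot: "pt_bullet (basis (dot d)) (basis t) = basis (brace d [t])"
  using bullet_tree_brace[of d "[]" t] by (simp add: pt_bullet_simps brace_Nil)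

lemma pt_sqcup_commute: "pt_sqcup p q = pt_sqcup q p"
proof (induction p rule: basis_induct)
  case (basis t)
  show ?case by (induction q rule: basis_induct) (simp_all add: pt_sqcup_simps sqcup_tree_commute)
qed (simp_all add: pt_sqcup_simps)

fun ptree_mono :: "letter list \<Rightarrow> label ptree" where
  "ptree_mono [] = dot L1"
| "ptree_mono (X0 # w) = brace L2 [ptree_mono w]"
| "ptree_mono (X1 # w) = sqcup_tree (dot L2) (ptree_mono w)"

section \<open>Vanishing of the relations and images of the monomials\<close>

locale com_prelie_words =
  fixes \<phi> :: "(label ptree \<Rightarrow>\<^sub>0 'k::field_char_0) \<Rightarrow> (letter list \<Rightarrow>\<^sub>0 'k)"
  assumes hom: "com_prelie_hom scale pt_bullet pt_sqcup scale word_bullet word_sqcup \<phi>"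
    and \<phi>_L1: "\<phi> (basis (dot L1)) = basis []"
    and \<phi>_L2: "\<phi> (basis (dot L2)) = basis [X1]"
begin

lemma linear: "Vector_Spaces.linear scale scale \<phi>"
  and \<phi>_bullet: "\<phi> (pt_bullet p q) = word_bullet (\<phi> p) (\<phi> q)"
  and \<phi>_sqcup: "\<phi> (pt_sqcup p q) = word_sqcup (\<phi> p) (\<phi> q)"
  using hom by (simp_all add: com_prelie_hom_def)

sublocale \<phi>: Vector_Spaces.linear scale scale \<phi>
  by (rule linear)

text \<open>\<open>bullet_tree_brace\<close> solved for its longest brace. The right side contains
  only braces with as many children as \<open>ts\<close>, which drives the inductions below.\<close>

lemma \<phi>_brace_snoc:
  "\<phi> (basis (brace d (ts @ [t]))) = word_bullet (\<phi> (basis (brace d ts))) (\<phi> (basis t)) -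
     (\<Sum>i<length ts. linear_ext (\<lambda>u. \<phi> (basis (brace d (ts[i := u])))) (bullet_tree (ts ! i) t))"
proof -
  have "basis (brace d (ts @ [t])) = pt_bullet (basis (brace d ts)) (basis t) -
     (\<Sum>i<length ts. linear_ext (\<lambda>u. basis (brace d (ts[i := u]))) (bullet_tree (ts ! i) t) :: _ \<Rightarrow>\<^sub>0 'k)"
    by (simp add: pt_bullet_simps bullet_tree_brace)
  then show ?thesis
    by (simp add: \<phi>.diff \<phi>.sum \<phi>_bullet linear_image_linear_ext[OF linear])
qed

lemma \<phi>_brace_single: "\<phi> (basis (brace d [t])) = word_bullet (\<phi> (basis (dot d))) (\<phi> (basis t))"
  using \<phi>_brace_snoc[of d "[]" t] by (simp add: brace_Nil)

text \<open>With one child, the empty word gives zero as left factor of the prelie product; with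
  more, every term of \<open>\<phi>_brace_snoc\<close> contains a shorter brace that vanishes by
  induction.\<close>

lemma \<phi>_brace_L1: "ts \<noteq> [] \<Longrightarrow> \<phi> (basis (brace L1 ts)) = 0"
proof (induction "length ts" arbitrary: ts)
  case (Suc n)
  then obtain us t where ts: "ts = us @ [t]" by (metis rev_exhaust)
  show ?case
  proof (cases "us = []")
    case True
    then show ?thesis by (simp add: ts \<phi>_brace_single \<phi>_L1 word_bullet_Nil_left)
  next
    case False
    then have IH: "\<phi> (basis (brace L1 vs)) = 0" if "length vs = length us" for vs
      using that Suc.hyps ts by (metis Suc_inject length_0_conv length_append_singleton)
    show ?thesis
      by (simp add: ts \<phi>_brace_snoc IH linear_ext_zero_fun word_bullet_def)
  qed
qed simp

lemma \<phi>_brace_L2_single: "\<phi> (basis (brace L2 [t])) = prepend X0 (\<phi> (basis t))"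
  by (simp add: \<phi>_brace_single \<phi>_L2 word_bullet_X1)

text \<open>Both \<open>(\<cdot>\<^sub>2 \<bullet> t) \<bullet> u\<close> and \<open>\<cdot>\<^sub>2 \<bullet> (t \<bullet> u)\<close> are mapped to
  \<open>x\<^sub>0 (\<phi> t \<bullet> \<phi> u)\<close>, so their difference \<open>\<cdot>\<^sub>2 \<bullet> t u\<close> vanishes.\<close>

lemma \<phi>_brace_L2_pair: "\<phi> (basis (brace L2 [t, u])) = 0"
proof -
  have "linear_ext (\<lambda>v. \<phi> (basis (brace L2 [v]))) p = prepend X0 (\<phi> p)" for p
    by (induction p rule: basis_induct)
      (simp_all add: linear_ext_add linear_ext_scale \<phi>.add \<phi>.scale prepend_simps \<phi>_brace_L2_single)
  then show ?thesis
    using \<phi>_brace_snoc[of L2 "[t]" u] \<phi>_bullet[of "basis t" "basis u"]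
    by (simp add: \<phi>_brace_L2_single word_bullet_prepend_X0 pt_bullet_simps)
qed

text \<open>The same induction as for \<open>L1\<close>, but started at two children, since by
  \<open>\<phi>_brace_L2_single\<close> a single child gives a word sum with first letter
  \<open>X0\<close>.\<close>

lemma \<phi>_brace_L2: "2 \<le> length ts \<Longrightarrow> \<phi> (basis (brace L2 ts)) = 0"
proof (induction "length ts" arbitrary: ts)
  case (Suc n)
  then obtain us t where ts: "ts = us @ [t]" by (metis length_0_conv nat.distinct(1) rev_exhaust)
  show ?case
  proof (cases "length us = 1")
    case True
    then obtain u where "us = [u]" by (metis One_nat_def length_0_conv length_Suc_conv)
    then show ?thesis by (simp add: ts \<phi>_brace_L2_pair)
  next
    case False
    then have IH: "\<phi> (basis (brace L2 vs)) = 0" if "length vs = length us" for vs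
      using that Suc ts by simp
    show ?thesis
      by (simp add: ts \<phi>_brace_snoc IH linear_ext_zero_fun word_bullet_def)
  qed
qed simp

lemma CPL_relations_subset_kernel: "CPL_relations \<subseteq> {p. \<phi> p = 0}"
proof -
  have "\<phi> (pt_sqcup (basis (dot L1)) (basis t) - basis t) = 0" for t
    by (simp add: \<phi>.diff \<phi>_sqcup \<phi>_L1 word_sqcup_Nil_left)
  \<comment> \<open>Relation 4 is mapped to the shuffle recursion with both first letters equal to
    \<open>X0\<close>.\<close>
  moreover have "\<phi> (pt_sqcup (pt_bullet (basis (dot L2)) p) (pt_bullet (basis (dot L2)) q)
        - pt_bullet (basis (dot L2)) (pt_sqcup (pt_bullet (basis (dot L2)) p) q
             + pt_sqcup p (pt_bullet (basis (dot L2)) q))) = 0" for p q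
    by (simp add: \<phi>.diff \<phi>.add \<phi>_sqcup \<phi>_bullet \<phi>_L2 word_bullet_X1 word_sqcup_prepend prepend_simps)
  moreover have "\<phi> (basis (brace L1 ts)) = 0" if "1 \<le> length ts" for ts
    using that by (intro \<phi>_brace_L1) auto
  ultimately show ?thesis using \<phi>_brace_L2 unfolding CPL_relations_def by auto
qed

lemma \<phi>_ptree_mono: "\<phi> (basis (ptree_mono w)) = word_mono w"
proof (induction w rule: ptree_mono.induct)
  case (3 w)
  have "\<phi> (basis (ptree_mono (X1 # w))) = \<phi> (pt_sqcup (basis (dot L2)) (basis (ptree_mono w)))"
    by (simp add: pt_sqcup_simps)
  then show ?case by (simp add: \<phi>_sqcup \<phi>_L2 3)
qed (simp_all add: \<phi>_L1 \<phi>_brace_L2_single)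

end

section \<open>Reduction modulo the relations\<close>

text \<open>The reduction is carried out modulo any ideal containing the relations and then applied
  to the generated one.\<close>

locale CPL_ideal =
  fixes I :: "(label ptree \<Rightarrow>\<^sub>0 'k::field_char_0) set"
  assumes ideal: "com_prelie_ideal scale pt_bullet pt_sqcup I"
    and relations: "CPL_relations \<subseteq> I"
begin

text \<open>Congruence modulo \<open>I\<close> to a combination of the trees
  \<open>ptree_mono w\<close>. The coefficients are kept as an element of the space of words, to
  which \<open>word_mono_independent\<close> applies.\<close>

definition reducible :: "(label ptree \<Rightarrow>\<^sub>0 'k) \<Rightarrow> bool" where
  "reducible p \<longleftrightarrow> (\<exists>q. p - linear_ext (\<lambda>w. basis (ptree_mono w)) q \<in> I)"

lemma subspace: "free_vs.subspace I"
  using ideal by (simp add: com_prelie_ideal_def)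

lemma ideal_closed:
  assumes "p \<in> I"
  shows "pt_bullet q p \<in> I" "pt_sqcup p q \<in> I" "pt_sqcup q p \<in> I"
  using assms ideal pt_sqcup_commute[of q p] by (simp_all add: com_prelie_ideal_def)

lemma reducible_ideal: "p \<in> I \<Longrightarrow> reducible p"
  unfolding reducible_def by (rule exI[of _ 0]) (simp add: linear_ext_def)

lemma reducible_ptree_mono: "reducible (basis (ptree_mono w))"
  unfolding reducible_def
  by (rule exI[of _ "basis w"]) (simp add: free_vs.subspace_0[OF subspace])

lemma reducible_add: "reducible p \<Longrightarrow> reducible q \<Longrightarrow> reducible (p + q)"
  unfolding reducible_def
proof (elim exE)
  fix p' q' assume "p - linear_ext (\<lambda>w. basis (ptree_mono w)) p' \<in> I"
    "q - linear_ext (\<lambda>w. basis (ptree_mono w)) q' \<in> I"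
  from free_vs.subspace_add[OF subspace this]
  show "\<exists>r. p + q - linear_ext (\<lambda>w. basis (ptree_mono w)) r \<in> I"
    by (intro exI[of _ "p' + q'"]) (simp add: linear_ext_add algebra_simps)
qed

lemma reducible_scale: "reducible p \<Longrightarrow> reducible (scale c p)"
  unfolding reducible_def
proof (elim exE)
  fix p' assume "p - linear_ext (\<lambda>w. basis (ptree_mono w)) p' \<in> I"
  from free_vs.subspace_scale[OF subspace this, of c]
  show "\<exists>r. scale c p - linear_ext (\<lambda>w. basis (ptree_mono w)) r \<in> I"
    by (intro exI[of _ "scale c p'"]) (simp add: linear_ext_scale free_vs.scale_right_diff_distrib)
qed

lemma reducible_cong:
  assumes "p - q \<in> I" "reducible q"
  shows "reducible p"
  using reducible_add[OF reducible_ideal[OF assms(1)] assms(2)] by simp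

text \<open>Such an \<open>f\<close> descends to the quotient by \<open>I\<close>, so its behaviour
  on the trees \<open>ptree_mono w\<close> decides.\<close>

lemma reducible_linear_image:
  assumes f: "Vector_Spaces.linear scale scale f" "\<And>p. p \<in> I \<Longrightarrow> f p \<in> I"
    and m: "\<And>w. reducible (f (basis (ptree_mono w)))" and p: "reducible p"
  shows "reducible (f p)"
proof -
  interpret f: Vector_Spaces.linear scale scale f by fact
  obtain q where q: "p - linear_ext (\<lambda>w. basis (ptree_mono w)) q \<in> I"
    using p by (auto simp: reducible_def)
  have "reducible (f (linear_ext (\<lambda>w. basis (ptree_mono w)) q))"
    by (induction q rule: basis_induct)
      (simp_all add: linear_ext_add linear_ext_scale f.add f.scale reducible_add reducible_scale m)
  moreover have "f p - f (linear_ext (\<lambda>w. basis (ptree_mono w)) q) \<in> I"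
    using f(2)[OF q] by (simp add: f.diff)
  ultimately show ?thesis by (rule reducible_cong[rotated])
qed

section \<open>Closure of reducible elements under the products\<close>

lemma linear_pt_bullet: "Vector_Spaces.linear scale scale (pt_bullet (p :: label ptree \<Rightarrow>\<^sub>0 'k))"
  and linear_pt_sqcup: "Vector_Spaces.linear scale scale (pt_sqcup (p :: label ptree \<Rightarrow>\<^sub>0 'k))"
  by unfold_locales (simp_all add: pt_bullet_simps pt_sqcup_simps)

lemma reducible_bullet_L2: "reducible p \<Longrightarrow> reducible (pt_bullet (basis (dot L2)) p)"
proof (rule reducible_linear_image[OF linear_pt_bullet])
  show "reducible (pt_bullet (basis (dot L2)) (basis (ptree_mono w)))" for w
    using reducible_ptree_mono[of "X0 # w"] by (simp add: pt_bullet_dot)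
qed (auto intro: ideal_closed)

lemma reducible_sqcup_L2: "reducible p \<Longrightarrow> reducible (pt_sqcup (basis (dot L2)) p)"
proof (rule reducible_linear_image[OF linear_pt_sqcup])
  show "reducible (pt_sqcup (basis (dot L2)) (basis (ptree_mono w)))" for w
    using reducible_ptree_mono[of "X1 # w"] by (simp add: pt_sqcup_simps)
qed (auto intro: ideal_closed)

lemma brace_in_ideal:
  "1 \<le> length ts \<Longrightarrow> basis (brace L1 ts) \<in> I"
  "2 \<le> length ts \<Longrightarrow> basis (brace L2 ts) \<in> I"
  using relations unfolding CPL_relations_def by blast+

lemma sqcup_L1_in_ideal: "pt_sqcup (basis (dot L1)) (basis t) - basis t \<in> I"
  using relations unfolding CPL_relations_def by blast

lemma sqcup_L2_in_ideal:
  "basis (sqcup_tree (brace L2 [t]) (brace L2 [u])) - pt_bullet (basis (dot L2))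
     (basis (sqcup_tree (brace L2 [t]) u) + basis (sqcup_tree t (brace L2 [u]))) \<in> I"
proof -
  have "pt_sqcup (pt_bullet (basis (dot L2)) (basis t)) (pt_bullet (basis (dot L2)) (basis u))
        - pt_bullet (basis (dot L2))
            (pt_sqcup (pt_bullet (basis (dot L2)) (basis t)) (basis u)
             + pt_sqcup (basis t) (pt_bullet (basis (dot L2)) (basis u))) \<in> I"
    using relations unfolding CPL_relations_def by blast
  then show ?thesis by (simp add: pt_bullet_dot pt_sqcup_simps)
qed

text \<open>The unit relation settles the case of an empty word, associativity the case of a leading
  \<open>X1\<close>, and relation 4 shortens the words if both start with \<open>X0\<close>.\<close>

lemma reducible_sqcup_mono: "reducible (basis (sqcup_tree (ptree_mono v) (ptree_mono w)))"
proof (induction "length v + length w" arbitrary: v w rule: less_induct)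
  case less
  have unit: "reducible (basis (sqcup_tree (dot L1) (ptree_mono u)))" for u
    using reducible_cong[OF sqcup_L1_in_ideal reducible_ptree_mono[of u]] by (simp add: pt_sqcup_simps)
  have IH: "reducible (basis (sqcup_tree (ptree_mono v') (ptree_mono w')))"
    if "length v' + length w' < length v + length w" for v' w'
    using less that by blast
  show ?case
  proof (cases v)
    case Nil
    then show ?thesis using unit by simp
  next
    case v: (Cons a v')
    show ?thesis
    proof (cases w)
      case Nil
      then show ?thesis using unit[of v] by (simp add: sqcup_tree_commute)
    next
      case w: (Cons b w')
      show ?thesis
      proof (cases a)
        case X1
        then show ?thesis using v reducible_sqcup_L2[OF IH[of v' w]]
          by (simp add: pt_sqcup_simps sqcup_tree_assoc)
      next
        case a: X0
        show ?thesis
        proof (cases b)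
          case X1
          then show ?thesis using w reducible_sqcup_L2[OF IH[of w' v]]
            by (simp add: pt_sqcup_simps sqcup_tree_assoc sqcup_tree_commute[of "ptree_mono v"])
        next
          case X0
          then show ?thesis
            using a v w reducible_cong[OF sqcup_L2_in_ideal reducible_bullet_L2[OF reducible_add]]
              IH[of v w'] IH[of v' w] by simp
        qed
      qed
    qed
  qed
qed

text \<open>The factors are reduced one after the other: first \<open>p\<close> against a fixed
  monomial, then \<open>q\<close> against \<open>p\<close>.\<close>

lemma reducible_sqcup:
  assumes p: "reducible p" and q: "reducible q"
  shows "reducible (pt_sqcup p q)"
proof (rule reducible_linear_image[OF linear_pt_sqcup _ _ q])
  fix w
  have "reducible (pt_sqcup (basis (ptree_mono w)) p)"
    by (rule reducible_linear_image[OF linear_pt_sqcup _ _ p])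
      (auto intro: ideal_closed simp: pt_sqcup_simps reducible_sqcup_mono)
  then show "reducible (pt_sqcup p (basis (ptree_mono w)))"
    by (simp add: pt_sqcup_commute)
qed (auto intro: ideal_closed)

text \<open>Relations 1 and 2 remove all braces except the single vertices and those of
  \<open>L2\<close> with one child.\<close>

lemma reducible_basis: "reducible (basis t)"
proof (induction t rule: ptree_induct)
  case (brace d ts)
  \<comment> \<open>The case rule of \<open>remdups_adj\<close> supplies the split into lists of
    length 0, 1 and at least 2.\<close>
  consider "ts = []" | t where "ts = [t]" | "2 \<le> length ts"
    by (cases ts rule: remdups_adj.cases) auto
  then show ?case
  proof cases
    case 1
    \<comment> \<open>\<open>ptree_mono [X1]\<close> is the product of \<open>dot L2\<close> with
      \<open>dot L1\<close>, so it agrees with \<open>dot L2\<close> only modulo relation 3.\<close>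
    have "reducible (basis (dot L2))"
    proof (rule reducible_cong[OF _ reducible_ptree_mono[of "[X1]"]])
      have "- (pt_sqcup (basis (dot L1)) (basis (dot L2)) - basis (dot L2)) \<in> I"
        by (rule free_vs.subspace_neg[OF subspace sqcup_L1_in_ideal])
      then show "basis (dot L2) - basis (ptree_mono [X1]) \<in> I"
        by (simp add: pt_sqcup_simps sqcup_tree_commute[of "dot L2"])
    qed
    then show ?thesis using 1 reducible_ptree_mono[of "[]"] by (cases d) (simp_all add: brace_Nil)
  next
    case 2
    show ?thesis
    proof (cases d)
      case L1
      then show ?thesis using 2 by (simp add: reducible_ideal brace_in_ideal)
    next
      case L2
      then show ?thesis using 2 brace reducible_bullet_L2[of "basis t"] by (simp add: pt_bullet_dot)
    qed
  next
    case 3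
    then show ?thesis by (cases d) (simp_all add: reducible_ideal brace_in_ideal)
  qed
next
  case (sqcup t u)
  then show ?case using reducible_sqcup by (simp flip: pt_sqcup_simps(5))
qed

lemma reducible: "reducible p"
  by (induction p rule: basis_induct) (simp_all add: reducible_basis reducible_add reducible_scale)

end

theorem theorem27:
  fixes \<phi> :: "(label ptree \<Rightarrow>\<^sub>0 'k::field_char_0) \<Rightarrow> (letter list \<Rightarrow>\<^sub>0 'k)"
  assumes "com_prelie_hom scale pt_bullet pt_sqcup scale word_bullet word_sqcup \<phi>"
    and "\<phi> (basis (dot L1)) = basis []"
    and "\<phi> (basis (dot L2)) = basis [X1]"
  shows "{p. \<phi> p = 0} = com_prelie_ideal_generated scale pt_bullet pt_sqcup CPL_relations"
proof -
  interpret com_prelie_words \<phi> by unfold_locales (use assms in auto)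
  let ?I = "com_prelie_ideal_generated scale pt_bullet pt_sqcup
    (CPL_relations :: (label ptree \<Rightarrow>\<^sub>0 'k) set)"
  interpret CPL_ideal ?I
    by unfold_locales (auto intro: com_prelie_ideal_ideal_generated free_vs.module_axioms
        subset_com_prelie_ideal_generated[THEN subsetD])
  have "com_prelie_ideal scale pt_bullet pt_sqcup {p. \<phi> p = 0}"
    by (rule com_prelie_ideal_kernel[OF assms(1)]) (simp_all add: word_bullet_def word_sqcup_def)
  then have I: "?I \<subseteq> {p. \<phi> p = 0}"
    by (rule com_prelie_ideal_generated_subset[OF _ CPL_relations_subset_kernel])
  moreover have "p \<in> ?I" if p: "\<phi> p = 0" for p
  proof -
    \<comment> \<open>The morphism kills \<open>p\<close> and the ideal, hence also the reduced form
      of \<open>p\<close>; independence makes that form zero, so \<open>p\<close> itself lies in the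
      ideal.\<close>
    obtain q where q: "p - linear_ext (\<lambda>w. basis (ptree_mono w)) q \<in> ?I"
      using reducible by (auto simp: reducible_def)
    then have "\<phi> (linear_ext (\<lambda>w. basis (ptree_mono w)) q) = 0"
      using I p by (auto simp: \<phi>.diff)
    then have "linear_ext word_mono q = 0"
      by (simp add: linear_image_linear_ext[OF linear] \<phi>_ptree_mono)
    then have "q = 0" by (rule word_mono_independent)
    then show ?thesis using q by (simp add: linear_ext_def)
  qed
  ultimately show ?thesis by blast
qed

end
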